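(* Let $a_0=0.61803\ldots$ be the unique positive root of $a^3+4a^2+2a=3$. For every $a\in(1/2,a_0]$, the density of $L_1$ is log-concave on $\mathbb R$.
   Context: Elephant random walk (ERW) with memory parameter $p\in[0,1]$ and first step parameter $q\in[0,1]$: $S_0=0$; the first step is $X_1=+1$ with probability $q$ and $X_1=-1$ with probability $1-q$; for $n\ge 1$, $X_{n+1}=+X_{\mathcal U(n)}$ with probability $p$ and $X_{n+1}=-X_{\mathcal U(n)}$ with probability $1-p$, where $\mathcal U(n)$ is uniform on $\{1,\dots,n\}$ and all choices are independent of each other and of the past; $S_{n+1}=S_n+X_{n+1}$, $S_1=X_1$. Set $a=2p-1$. For $a\in(1/2,1)$ it is known that $n^{-a}S_n$ converges almost surely to a non-degenerate random variable $L_q$; $L_1$ is this limit when $q=1$. It is known that $L_1$ has a density on $\mathbb R$ (defined up to Lebesgue-null sets; the statement concerns a suitable version). A nonnegative function $f$ on $\mathbb R$ is log-concave if $f(\lambda x+(1-\lambda)y)\ge f(x)^\lambda f(y)^{1-\lambda}$ for all $x,y\in\mathbb R$, $\lambda\in(0,1)$. *)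

theory Defs
  imports "HOL-Probability.Probability"
begin

text \<open>
  The random choices driving an elephant random walk: the first step, the remembered time
  \<open>U n\<close>, and the sign with which the remembered step is repeated. They are indexed jointly so
  that their mutual independence is a single statement.
\<close>

datatype erw_choice = First_Step | Recall nat | Sign nat

locale elephant_random_walk = prob_space M
  for M :: "'w measure" +
  fixes p q :: real
    and X :: "nat \<Rightarrow> 'w \<Rightarrow> int"
    and U :: "nat \<Rightarrow> 'w \<Rightarrow> nat"
    and \<epsilon> :: "nat \<Rightarrow> 'w \<Rightarrow> int"
  assumes p_range: "0 \<le> p" "p \<le> 1"
    and q_range: "0 \<le> q" "q \<le> 1"
    and measurable_X: "\<And>n. n \<ge> 1 \<Longrightarrow> X n \<in> measurable M (count_space UNIV)"
    and measurable_U: "\<And>n. n \<ge> 1 \<Longrightarrow> U n \<in> measurable M (count_space UNIV)"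
    and measurable_sign: "\<And>n. n \<ge> 1 \<Longrightarrow> \<epsilon> n \<in> measurable M (count_space UNIV)"
    and first_step:
      "prob {\<omega> \<in> space M. X 1 \<omega> = 1} = q"
      "prob {\<omega> \<in> space M. X 1 \<omega> = -1} = 1 - q"
    and recall_uniform:
      "\<And>n k. n \<ge> 1 \<Longrightarrow> k \<in> {1..n} \<Longrightarrow> prob {\<omega> \<in> space M. U n \<omega> = k} = 1 / real n"
    and sign_law:
      "\<And>n. n \<ge> 1 \<Longrightarrow> prob {\<omega> \<in> space M. \<epsilon> n \<omega> = 1} = p"
      "\<And>n. n \<ge> 1 \<Longrightarrow> prob {\<omega> \<in> space M. \<epsilon> n \<omega> = -1} = 1 - p"
    and choices_indep:
      "indep_vars (\<lambda>_. count_space UNIV)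
         (\<lambda>c. case c of First_Step \<Rightarrow> X 1 | Recall n \<Rightarrow> (\<lambda>\<omega>. int (U n \<omega>)) | Sign n \<Rightarrow> \<epsilon> n)
         ({First_Step} \<union> Recall ` {1..} \<union> Sign ` {1..})"
    and step: "\<And>n. n \<ge> 1 \<Longrightarrow> AE \<omega> in M. X (Suc n) \<omega> = \<epsilon> n \<omega> * X (U n \<omega>) \<omega>"

definition erw_position :: "(nat \<Rightarrow> 'w \<Rightarrow> int) \<Rightarrow> nat \<Rightarrow> 'w \<Rightarrow> int" where
  "erw_position X n \<omega> = (\<Sum>i = 1..n. X i \<omega>)"

definition is_erw_limit ::
    "'w measure \<Rightarrow> real \<Rightarrow> (nat \<Rightarrow> 'w \<Rightarrow> int) \<Rightarrow> ('w \<Rightarrow> real) \<Rightarrow> bool" where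
  "is_erw_limit M a X L \<longleftrightarrow>
     L \<in> borel_measurable M \<and>
     (AE \<omega> in M. (\<lambda>n. real n powr (- a) * real_of_int (erw_position X n \<omega>)) \<longlonglongrightarrow> L \<omega>)"

definition log_concave :: "(real \<Rightarrow> real) \<Rightarrow> bool" where
  "log_concave f \<longleftrightarrow>
     (\<forall>x. 0 \<le> f x) \<and>
     (\<forall>x y l. 0 < l \<and> l < 1 \<longrightarrow>
        f (l * x + (1 - l) * y) \<ge> f x powr l * f y powr (1 - l))"

definition erw_a0 :: real where
  "erw_a0 = (THE a. 0 < a \<and> a ^ 3 + 4 * a ^ 2 + 2 * a = 3)"

lemma erw_a0_unique_root: "\<exists>!a::real. 0 < a \<and> a ^ 3 + 4 * a ^ 2 + 2 * a = 3"
proof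
  have "sqrt 5 > (1::real)" by simp
  moreover have s: "sqrt 5 * sqrt 5 = (5::real)" by simp
  ultimately show "0 < (sqrt 5 - 1) / 2 \<and>
      ((sqrt 5 - 1) / 2) ^ 3 + 4 * ((sqrt 5 - 1) / 2) ^ 2 + 2 * ((sqrt 5 - 1) / 2) = (3::real)"
    by (simp add: power2_eq_square power3_eq_cube field_simps)
next
  fix b :: real
  assume b: "0 < b \<and> b ^ 3 + 4 * b ^ 2 + 2 * b = 3"
  have "(b + 3) * (b ^ 2 + b - 1) = 0"
    using b by (simp add: power2_eq_square power3_eq_cube algebra_simps)
  then have "b ^ 2 + b - 1 = 0" using b by auto
  then have "(2 * b + 1) ^ 2 = 5" by (simp add: power2_eq_square algebra_simps)
  then have "sqrt 5 = 2 * b + 1" using b by (intro real_sqrt_unique) auto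
  then show "b = (sqrt 5 - 1) / 2" by simp
qed

lemma erw_a0_root: "0 < erw_a0" "erw_a0 ^ 3 + 4 * erw_a0 ^ 2 + 2 * erw_a0 = 3"
  using theI'[OF erw_a0_unique_root] unfolding erw_a0_def by auto

lemma erw_a0_bounds: "0.61803 < erw_a0" "erw_a0 < 0.61804"
proof -
  have mono: "x ^ 3 + 4 * x ^ 2 + 2 * x \<le> y ^ 3 + 4 * y ^ 2 + 2 * y"
    if "0 \<le> x" "x \<le> y" for x y :: real
    using that power_mono[of x y 3] power_mono[of x y 2] by linarith
  show "0.61803 < erw_a0"
    using mono[of erw_a0 "0.61803"] erw_a0_root
    by (auto simp: not_less[symmetric] power2_eq_square power3_eq_cube)
  show "erw_a0 < 0.61804"
    using mono[of "0.61804" erw_a0] erw_a0_root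
    by (auto simp: not_less[symmetric] power2_eq_square power3_eq_cube)
qed

end

theory Submission
  imports Defs "HOL-Real_Asymp.Real_Asymp"
begin

text \<open>
  With \<open>q = 1\<close>, the number of up-steps up to time \<open>n\<close> is a Markov chain: from \<open>k\<close> it increases by one with
  probability \<open>(1 - a) / 2 + a k / n\<close>. This probability is affine in \<open>k\<close>, and because of this one step of
  the chain preserves log-concavity of the law as soon as \<open>n \<ge> 5\<close>; that the law at time \<open>5\<close> is
  log-concave is a polynomial check. (At time \<open>3\<close> log-concavity is exactly
  \<open>a\<^sup>3 + 4 a\<^sup>2 + 2 a \<le> 3\<close>, and \<open>a\<^sup>3 + 4 a\<^sup>2 + 2 a - 3 = (a + 3) (a\<^sup>2 + a - 1)\<close>, so the condition used is
  \<open>a\<^sup>2 + a \<le> 1\<close>.) The same recursion bounds the point masses by a multiple of \<open>n powr (- a)\<close>, so that the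
  distribution function \<open>F\<close> of the limit is Lipschitz, and log-concavity of sums over windows makes
  \<open>x \<mapsto> F (x + h) - F x\<close> log-concave for every \<open>h > 0\<close>. Along \<open>h = 2 powr (- k)\<close> the difference quotients of
  \<open>F\<close> are eventually monotone at each point, and their limit is a log-concave density by dominated
  convergence.
\<close>

section \<open>The law of the number of up-steps\<close>

text \<open>Two obstacles shape the argument. Almost sure convergence controls only the distribution
  function \<open>F\<close>; no convergence of rescaled point masses is at hand, so log-concavity
  can pass to the limit only through sums over windows. Then a limit of difference quotients is
  wanted at every point, not just almost everywhere; halving the scale provides it, since each
  increment is the sum of two increments at half the scale. One step keeps log-concavity because
  weights at neighbouring states differ by the constant \<open>\<delta> = a / (n + 1)\<close>. The
  defect at a new state is a combination of old defects in which only the coefficient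
  \<open>b * d - \<delta>\<close> has a doubtful sign, where \<open>b\<close> is the chance to move
  up from the state below and \<open>d\<close> the chance to stay. Both are at least
  \<open>(1 - a) / 2\<close>, and for \<open>n \<ge> 4\<close> a crude estimate of
  \<open>\<delta>\<close> reduces the sign question to \<open>a\<^sup>2 + a \<le> 1\<close>, the
  very condition found at time 3.\<close>

text \<open>\<open>erw_weight a n k\<close> is the probability of an up-step at time \<open>n + 2\<close>, given \<open>k\<close> up-steps among the
  first \<open>n + 1\<close>; \<open>erw_law a n\<close> is the law of the number of up-steps at time \<open>n + 1\<close>.\<close>

definition erw_weight :: "real \<Rightarrow> nat \<Rightarrow> int \<Rightarrow> real" where
  "erw_weight a n k = (1 - a) / 2 + a * real_of_int k / real (Suc n)"

fun erw_law :: "real \<Rightarrow> nat \<Rightarrow> int \<Rightarrow> real" where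
  "erw_law a 0 k = of_bool (k = 1)"
| "erw_law a (Suc n) k =
     (1 - erw_weight a n k) * erw_law a n k + erw_weight a n (k - 1) * erw_law a n (k - 1)"

declare erw_law.simps(2) [simp del]

lemma erw_law_eq_0: "k < 1 \<or> k > int n + 1 \<Longrightarrow> erw_law a n k = 0"
proof (induction n arbitrary: k)
  case (Suc n)
  show ?case
    using Suc.prems by (auto simp: Suc.IH erw_weight_def erw_law.simps(2))
qed auto

lemma erw_weight_bounds:
  fixes a :: real
  assumes "0 \<le> a" "1 \<le> k" "k \<le> int n + 1"
  shows "(1 - a) / 2 \<le> erw_weight a n k" and "erw_weight a n k \<le> (1 + a) / 2"
proof -
  show "(1 - a) / 2 \<le> erw_weight a n k"
    using assms by (simp add: erw_weight_def)
  have "a * real_of_int k \<le> a * real (Suc n)"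
    using assms by (intro mult_left_mono) auto
  then have "a * real_of_int k / real (Suc n) \<le> a"
    by (simp add: divide_le_eq)
  moreover have "(1 + a) / 2 = (1 - a) / 2 + a" by (simp add: field_simps)
  ultimately show "erw_weight a n k \<le> (1 + a) / 2"
    unfolding erw_weight_def by linarith
qed

lemma erw_weight_pred: "erw_weight a n (k - 1) = erw_weight a n k - a / real (Suc n)"
  unfolding erw_weight_def by (simp add: right_diff_distrib diff_divide_distrib del: of_nat_Suc)

lemma erw_weight_0 [simp]: "erw_weight a n 0 = (1 - a) / 2"
  by (simp add: erw_weight_def)

lemma erw_law_pos:
  assumes "0 \<le> a" "a < 1" "1 \<le> k" "k \<le> int n + 1"
  shows "0 < erw_law a n k"
  using assms(3,4)
proof (induction n arbitrary: k)
  case (Suc n)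
  have 1: "0 < (1 - erw_weight a n k) * erw_law a n k" if "k \<le> int n + 1"
    using erw_weight_bounds(2)[of a k n] Suc.IH[of k] assms Suc.prems that
    by (intro mult_pos_pos) auto
  have 2: "0 < erw_weight a n (k - 1) * erw_law a n (k - 1)" if "2 \<le> k"
    using erw_weight_bounds(1)[of a "k - 1" n] Suc.IH[of "k - 1"] assms Suc.prems that
    by (intro mult_pos_pos) auto
  consider "k = 1" | "k = int n + 2" | "2 \<le> k" "k \<le> int n + 1"
    using Suc.prems by force
  then show ?case
  proof cases
    case 3
    then show ?thesis
      using 1 2 by (auto simp: erw_law.simps(2) add_pos_pos)
  qed (use 1 2 erw_law_eq_0[of 0 n a] erw_law_eq_0[of k n a] in \<open>simp_all add: erw_law.simps(2)\<close>)
qed auto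

lemma erw_law_nonneg:
  assumes "0 \<le> a" "a < 1"
  shows "0 \<le> erw_law a n k"
  using erw_law_pos[OF assms, of k n] erw_law_eq_0[of k n a] by (cases "1 \<le> k \<and> k \<le> int n + 1") force+

text \<open>Both coefficients of the recursion are at most 1 on the support, so a step at most
  doubles the maximum. This crude bound starts the next induction at \<open>n = 3\<close>.\<close>

lemma erw_law_le_power2:
  assumes "0 \<le> a" "a < 1"
  shows "erw_law a n k \<le> 2 ^ n"
proof (induction n arbitrary: k)
  case (Suc n)
  have 1: "(1 - erw_weight a n k) * erw_law a n k \<le> 1 * 2 ^ n"
  proof (cases "1 \<le> k \<and> k \<le> int n + 1")
    case True
    show ?thesis
      using erw_weight_bounds[of a k n] assms Suc.IH[of k] True erw_law_nonneg[of a n k]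
      by (intro mult_mono) auto
  qed (use erw_law_eq_0 in force)
  have 2: "erw_weight a n (k - 1) * erw_law a n (k - 1) \<le> 1 * 2 ^ n"
  proof (cases "1 \<le> k - 1 \<and> k - 1 \<le> int n + 1")
    case True
    show ?thesis
      using erw_weight_bounds[of a "k - 1" n] assms Suc.IH[of "k - 1"] True erw_law_nonneg[of a n "k - 1"]
      by (intro mult_mono) auto
  qed (use erw_law_eq_0[of "k - 1" n a] in force)
  show ?case using 1 2 by (simp add: erw_law.simps(2))
qed auto

text \<open>The two weights feeding \<open>erw_law a (Suc n) k\<close> add up to \<open>1 - a / (n + 1)\<close>; both are nonnegative
  once \<open>n \<ge> 3\<close>.\<close>

lemma erw_law_le_powr:
  assumes "0 \<le> a" "a \<le> 2 / 3" "3 \<le> n"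
  shows "erw_law a n k \<le> 32 * real (Suc n) powr (- a)"
  using assms(3)
proof (induction n arbitrary: k rule: dec_induct)
  case base
  have "erw_law a 3 k \<le> 8"
    using erw_law_le_power2[of a 3 k] assms by simp
  \<comment> \<open>The constant 32 is \<open>8 * 4\<close>: the crude bound 8 at
    \<open>n = 3\<close>, divided by \<open>4 powr (- 1)\<close>.\<close>
  moreover have "4 powr (- 1) \<le> 4 powr (- a)"
    using assms by (intro powr_mono) auto
  ultimately show ?case by (simp add: powr_minus)
next
  case (step n)
  define b where "b = erw_weight a n (k - 1)"
  define d where "d = 1 - erw_weight a n k"
  define m where "m = 32 * real (Suc n) powr (- a)"
  have bd: "b + d = 1 - a / real (Suc n)"
    by (simp add: b_def d_def erw_weight_pred)
  \<comment> \<open>Here \<open>a \<le> 2 / 3\<close> enters: since \<open>n \<ge> 3\<close>, the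
    left side is at most \<open>1 / 6\<close>, and the right side is at least
    \<open>1 / 6\<close>.\<close>
  have small: "a / real (Suc n) \<le> (1 - a) / 2"
  proof -
    have "a / real (Suc n) \<le> (2 / 3) / 4"
      using assms step by (intro frac_le) auto
    also have "\<dots> \<le> (1 - a) / 2" using assms by simp
    finally show ?thesis .
  qed
  have *: "(1 - a / real (Suc n)) * m \<le> 32 * real (Suc (Suc n)) powr (- a)"
  proof -
    \<comment> \<open>With \<open>y = 1 / (n + 1)\<close>, the bounds
      \<open>1 - a * y \<le> exp (- a * y)\<close> and \<open>ln (1 + y) \<le> y\<close> show that
      the contraction factor is at most the ratio of consecutive values of
      \<open>powr (- a)\<close>.\<close>
    have "(1 - a / real (Suc n)) \<le> exp (- (a * (1 / real (Suc n))))"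
      using exp_ge_add_one_self[of "- (a * (1 / real (Suc n)))"] by simp
    also have "\<dots> \<le> exp (- (a * ln (real (Suc (Suc n)) / real (Suc n))))"
    proof -
      have "ln (real (Suc (Suc n)) / real (Suc n)) \<le> real (Suc (Suc n)) / real (Suc n) - 1"
        by (intro ln_le_minus_one) auto
      also have "\<dots> = 1 / real (Suc n)" by (simp add: field_simps)
      finally show ?thesis using assms by (simp only: exp_le_cancel_iff neg_le_iff_le mult_left_mono)
    qed
    also have "\<dots> = (real (Suc (Suc n)) / real (Suc n)) powr (- a)"
      by (simp add: powr_def)
    finally have "(1 - a / real (Suc n)) * m \<le> (real (Suc (Suc n)) / real (Suc n)) powr (- a) * m"
      by (intro mult_right_mono) (auto simp: m_def)
    also have "\<dots> = 32 * real (Suc (Suc n)) powr (- a)"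
      unfolding m_def by (subst powr_divide) (auto simp del: of_nat_Suc)
    finally show ?thesis .
  qed
  show ?case
  proof (cases "1 \<le> k \<and> k \<le> int n + 2")
    case True
    \<comment> \<open>At \<open>k = 1\<close> and \<open>k = n + 2\<close> one of the two states
      lies outside the support, where \<open>erw_weight_bounds\<close> is silent. The signs are
      checked there as well, because \<open>m\<close> will replace both law values.\<close>
    have "0 \<le> b"
    proof (cases "k = 1")
      case True then show ?thesis using assms by (simp add: b_def)
    next
      case False
      then show ?thesis using True assms erw_weight_bounds(1)[of a "k - 1" n] by (simp add: b_def)
    qed
    moreover have "0 \<le> d"
    proof (cases "k = int n + 2")
      case True
      then have "erw_weight a n (k - 1) = (1 + a) / 2"
        by (simp add: erw_weight_def field_simps)
      then have "d = (1 - a) / 2 - a / real (Suc n)"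
        unfolding d_def erw_weight_pred by (simp add: field_simps del: of_nat_Suc)
      then show ?thesis using small by simp
    next
      case False
      then show ?thesis
        using True assms erw_weight_bounds(2)[of a k n] unfolding d_def by auto
    qed
    ultimately have "d * erw_law a n k + b * erw_law a n (k - 1) \<le> d * m + b * m"
      using step.IH unfolding m_def by (intro add_mono mult_left_mono) auto
    also have "\<dots> = (1 - a / real (Suc n)) * m"
      by (simp add: algebra_simps del: of_nat_Suc flip: bd)
    finally show ?thesis using * by (simp add: b_def d_def erw_law.simps(2))
  next
    case False
    then have "erw_law a (Suc n) k = 0"
      by (intro erw_law_eq_0) auto
    then show ?thesis by simp
  qed
qed

section \<open>Log-concave sequences\<close>

text \<open>The inequalities with \<open>i = j\<close> alone would allow gaps of zeros between
  positive values; the off-diagonal form excludes them and permits exchanges without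
  division.\<close>

definition lc_seq :: "(int \<Rightarrow> real) \<Rightarrow> bool" where
  "lc_seq g \<longleftrightarrow> (\<forall>i j. i \<le> j \<longrightarrow> g (i - 1) * g (j + 1) \<le> g i * g j)"

text \<open>At a fixed sum of indices the product grows as the indices approach each other, one unit
  at a time. The case split only decides which of \<open>i\<close> and \<open>j\<close> is the
  smaller.\<close>

lemma lc_seqD_shift:
  assumes "lc_seq g" "k \<le> i" "k \<le> j" "i + j = k + m"
  shows "g k * g m \<le> g i * g j"
proof -
  have *: "g (i - int t) * g (j + int t) \<le> g i * g j" if "i \<le> j" for i j t
  proof (induction t)
    case (Suc t)
    have "g (i - int t - 1) * g (j + int t + 1) \<le> g (i - int t) * g (j + int t)"
      using assms(1) that unfolding lc_seq_def by (auto elim!: allE)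
    then show ?case using Suc by (simp add: algebra_simps)
  qed simp
  show ?thesis
  proof (cases "i \<le> j")
    case True
    have "k = i - int (nat (i - k))" "m = j + int (nat (i - k))" using assms by auto
    then show ?thesis using *[OF True] by metis
  next
    case False
    have "k = j - int (nat (j - k))" "m = i + int (nat (j - k))" using assms by auto
    then show ?thesis using *[of j i] False by (metis linear mult.commute)
  qed
qed

text \<open>On a support without gaps the diagonal inequalities suffice: to widen the distance of
  the indices by one, multiply the induction hypothesis by the inequality at \<open>j\<close> and
  cancel \<open>g (j - 1) * g j\<close>, which is positive inside the support.\<close>

lemma lc_seqI:
  fixes g :: "int \<Rightarrow> real" and u v :: int
  assumes pos: "\<And>k. u \<le> k \<Longrightarrow> k \<le> v \<Longrightarrow> 0 < g k"
    and zero: "\<And>k. k < u \<or> v < k \<Longrightarrow> g k = 0"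
    and lc: "\<And>k. u < k \<Longrightarrow> k < v \<Longrightarrow> g (k - 1) * g (k + 1) \<le> (g k)\<^sup>2"
  shows "lc_seq g"
proof -
  have nonneg: "0 \<le> g k" for k
    using pos[of k] zero[of k] by force
  have lc': "g (k - 1) * g (k + 1) \<le> (g k)\<^sup>2" for k
    using lc[of k] zero[of "k - 1"] zero[of "k + 1"] by force
  have *: "g (i - 1) * g (i + int t + 1) \<le> g i * g (i + int t)" for i t
  proof (induction t)
    case 0
    then show ?case using lc'[of i] by (simp add: power2_eq_square)
  next
    case (Suc t)
    define j where "j = i + int t + 1"
    have j: "i + int t = j - 1" "i + int (Suc t) = j"
      by (auto simp: j_def)
    have IH: "g (i - 1) * g j \<le> g i * g (j - 1)"
      using Suc by (simp add: j_def)
    have "g (i - 1) * g (j + 1) \<le> g i * g j"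
    proof (cases "u \<le> i - 1 \<and> j + 1 \<le> v")
      case True
      have "0 < g (j - 1) * g j"
        using True unfolding j_def by (intro mult_pos_pos pos) auto
      have "(g (i - 1) * g j) * (g (j - 1) * g (j + 1)) \<le> (g i * g (j - 1)) * (g j)\<^sup>2"
        by (rule mult_mono[OF IH lc']) (simp_all add: nonneg)
      then have "(g (i - 1) * g (j + 1)) * (g (j - 1) * g j) \<le> (g i * g j) * (g (j - 1) * g j)"
        by (simp only: power2_eq_square mult_ac)
      then show ?thesis
        using \<open>0 < g (j - 1) * g j\<close> by (rule mult_right_le_imp_le)
    next
      case False
      then have "g (i - 1) = 0 \<or> g (j + 1) = 0"
        using zero by force
      then show ?thesis using nonneg by auto
    qed
    then show ?case by (simp only: j)
  qed
  show ?thesis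
    unfolding lc_seq_def
  proof (intro allI impI)
    fix i j :: int assume "i \<le> j"
    then show "g (i - 1) * g (j + 1) \<le> g i * g j"
      using *[of i "nat (j - i)"] by simp
  qed
qed

text \<open>Writing the window sums as \<open>S = B + V = U + Y\<close>, where \<open>B\<close>, \<open>Y\<close> are the first and last \<open>t\<close> terms,
  and \<open>A\<close>, \<open>Z\<close> for the \<open>t\<close> terms before and after the window,
  \<open>S\<^sup>2 - (A + U) (V + Z) = (U B - A V) + (Y V - U Z) + (Y B - A Z)\<close>.\<close>

lemma lc_seq_window:
  fixes g :: "int \<Rightarrow> real"
  assumes lc: "lc_seq g" and "0 \<le> t" "0 \<le> w"
  shows "sum g {k<..k + w} * sum g {k + 2 * t<..k + 2 * t + w} \<le> (sum g {k + t<..k + t + w})\<^sup>2"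
proof -
  have shift: "sum g {x + s<..y + s} = (\<Sum>i\<in>{x<..y}. g (i + s))" for x y s :: int
    by (rule sum.reindex_bij_witness[of _ "\<lambda>i. i + s" "\<lambda>i. i - s"]) auto
  \<comment> \<open>The condition \<open>x' \<le> y + 1\<close> puts every \<open>i\<close> of the
    first block at or below every \<open>j\<close> of the second, so handing the shift
    \<open>s\<close> from \<open>j\<close> to \<open>i\<close> keeps both indices between
    \<open>i\<close> and \<open>j + s\<close>.\<close>
  have prod: "sum g {x<..x'} * sum g {y + s<..y' + s} \<le> sum g {x + s<..x' + s} * sum g {y<..y'}"
    if "0 \<le> s" "x' \<le> y + 1" for x x' y y' s
  proof -
    have "sum g {x<..x'} * sum g {y + s<..y' + s} = (\<Sum>i\<in>{x<..x'}. \<Sum>j\<in>{y<..y'}. g i * g (j + s))"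
      by (simp add: shift sum_product)
    also have "\<dots> \<le> (\<Sum>i\<in>{x<..x'}. \<Sum>j\<in>{y<..y'}. g (i + s) * g j)"
      using that by (intro sum_mono lc_seqD_shift[OF lc]) auto
    also have "\<dots> = sum g {x + s<..x' + s} * sum g {y<..y'}"
      by (simp add: shift sum_product)
    finally show ?thesis .
  qed
  have split: "sum g {x<..z} = sum g {x<..y} + sum g {y<..z}" if "x \<le> y" "y \<le> z" for x y z :: int
  proof -
    have "{x<..z} = {x<..y} \<union> {y<..z}" using that by auto
    then show ?thesis by (simp add: sum.union_disjoint Int_def) 
  qed
  show ?thesis
  proof (cases "w \<le> t")
    \<comment> \<open>The left window ends before the middle one begins, so whole windows can be
      exchanged at once.\<close>
    case True
    show ?thesis
      using prod[of t "k + w" "k + t" k "k + t + w"] True assms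
      by (simp add: algebra_simps power2_eq_square)
  next
    case False
    define A where "A = sum g {k<..k + t}"
    define B where "B = sum g {k + t<..k + 2 * t}"
    define Y where "Y = sum g {k + w<..k + t + w}"
    define Z where "Z = sum g {k + t + w<..k + 2 * t + w}"
    define U where "U = sum g {k + t<..k + w}"
    define V where "V = sum g {k + 2 * t<..k + t + w}"
    have s: "sum g {k<..k + w} = A + U" "sum g {k + 2 * t<..k + 2 * t + w} = V + Z"
      "sum g {k + t<..k + t + w} = B + V" "sum g {k + t<..k + t + w} = U + Y"
      unfolding A_def B_def Y_def Z_def U_def V_def using False assms by (intro split; simp)+
    have "A * V \<le> B * U"
      using prod[of t "k + t" "k + t" k "k + w"] assms unfolding A_def B_def U_def V_def
      by (simp add: algebra_simps)
    moreover have "U * Z \<le> V * Y"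
      using prod[of t "k + w" "k + w" "k + t" "k + t + w"] assms unfolding U_def V_def Y_def Z_def
      by (simp add: algebra_simps)
    moreover have "A * Z \<le> B * Y"
      using prod[of t "k + t" "k + w" k "k + t + w"] assms False unfolding A_def B_def Y_def Z_def
      by (simp add: algebra_simps)
    moreover have "(sum g {k + t<..k + t + w})\<^sup>2 = (B + V) * (U + Y)"
      by (simp add: power2_eq_square flip: s(3) s(4))
    moreover have "(A + U) * (V + Z) = A * V + U * Z + A * Z + U * V"
      "(B + V) * (U + Y) = B * U + V * Y + B * Y + U * V"
      by algebra+
    ultimately show ?thesis
      unfolding s(1,2) by linarith
  qed
qed

text \<open>The difference of the two sides is an explicit combination of the defects of
  \<open>f0\<close>, ..., \<open>f3\<close>; the relation \<open>b + d = 1 - \<delta>\<close> turns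
  the coefficient of \<open>f1 * f2\<close> into \<open>b * d - \<delta>\<close>. The remaining
  bracket, with factor \<open>\<delta>\<^sup>2\<close>, is nonnegative by the arithmetic-geometric
  mean inequality, as \<open>(f0 * f3)\<^sup>2 \<le> (f0 * f2) * (f1 * f3)\<close>.\<close>

lemma lc_step_ineq:
  fixes f0 f1 f2 f3 b d \<delta> :: real
  assumes nonneg: "0 \<le> f0" "0 \<le> f1" "0 \<le> f2" "0 \<le> f3"
    and lc: "f0 * f2 \<le> f1\<^sup>2" "f1 * f3 \<le> f2\<^sup>2" "f0 * f3 \<le> f1 * f2"
    and bd: "b + d = 1 - \<delta>" "\<delta> \<le> b * d"
  shows "((d + \<delta>) * f1 + (b - \<delta>) * f0) * ((d - \<delta>) * f3 + (b + \<delta>) * f2) \<le> (d * f2 + b * f1)\<^sup>2"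
proof -
  have "(2 * (f0 * f3))\<^sup>2 \<le> 4 * ((f1 * f3) * (f0 * f2))"
  proof -
    have "(f0 * f3) * (f0 * f3) \<le> (f0 * f3) * (f1 * f2)"
      using lc(3) nonneg by (simp add: mult_left_mono)
    moreover have "(2 * (f0 * f3))\<^sup>2 = 4 * ((f0 * f3) * (f0 * f3))"
      "(f1 * f3) * (f0 * f2) = (f0 * f3) * (f1 * f2)"
      by (simp_all add: power2_eq_square)
    ultimately show ?thesis by linarith
  qed
  also have "\<dots> \<le> (f1 * f3 + f0 * f2)\<^sup>2"
    using sum_squares_bound[of "f1 * f3" "f0 * f2"] unfolding power2_sum by linarith
  finally have "0 \<le> f1 * f3 + f0 * f2 - 2 * (f0 * f3)"
    using power2_le_imp_le[of "2 * (f0 * f3)" "f1 * f3 + f0 * f2"] nonneg by simp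
  then have "0 \<le> d\<^sup>2 * (f2\<^sup>2 - f1 * f3) + b\<^sup>2 * (f1\<^sup>2 - f0 * f2) + (b * d - \<delta>) * (f1 * f2 - f0 * f3)
      + \<delta>\<^sup>2 * (f1 * f3 + f0 * f2 - 2 * (f0 * f3))"
    using lc bd by (intro add_nonneg_nonneg mult_nonneg_nonneg) auto
  also have "\<dots> = (d * f2 + b * f1)\<^sup>2
      - ((d + \<delta>) * f1 + (b - \<delta>) * f0) * ((d - \<delta>) * f3 + (b + \<delta>) * f2)"
  proof -
    have d: "d = 1 - \<delta> - b" using bd by linarith
    show ?thesis unfolding d by (simp add: power2_eq_square algebra_simps)
  qed
  finally show ?thesis by simp
qed

section \<open>Explicit laws up to time 5\<close>

lemma erw_law_1:
  fixes a :: real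
  shows "erw_law a 1 1 = (1 - a) / 2" and "erw_law a 1 2 = (1 + a) / 2"
  by (simp_all add: One_nat_def erw_law.simps(2) erw_weight_def) (simp_all add: field_simps)

lemma erw_law_2:
  fixes a :: real
  shows "erw_law a 2 1 = (2 - 2 * a) / 8"
    and "erw_law a 2 2 = (4 - 2 * a - 2 * a ^ 2) / 8"
    and "erw_law a 2 3 = (2 + 4 * a + 2 * a ^ 2) / 8"
proof -
  have step: "erw_law a 2 k =
    (2 + (2 * a - 2 * a * k)) / 4 * erw_law a 1 k +
    (2 - (2 * a - 2 * a * (k - 1))) / 4 * erw_law a 1 (k - 1)" for k
    using erw_law.simps(2)[of a 1 k] by (simp add: erw_weight_def field_simps eval_nat_numeral)
  show "erw_law a 2 1 = (2 - 2 * a) / 8"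
    unfolding step[of 1]
    by (simp add: erw_law_1[unfolded One_nat_def] erw_law_eq_0) (simp add: field_simps power_numeral_reduce)?
  show "erw_law a 2 2 = (4 - 2 * a - 2 * a ^ 2) / 8"
    unfolding step[of 2]
    by (simp add: erw_law_1[unfolded One_nat_def] erw_law_eq_0) (simp add: field_simps power_numeral_reduce)?
  show "erw_law a 2 3 = (2 + 4 * a + 2 * a ^ 2) / 8"
    unfolding step[of 3]
    by (simp add: erw_law_1[unfolded One_nat_def] erw_law_eq_0) (simp add: field_simps power_numeral_reduce)?
qed

lemma erw_law_3:
  fixes a :: real
  shows "erw_law a 3 1 = (6 - 4 * a - 2 * a ^ 2) / 48"
    and "erw_law a 3 2 = (18 - 18 * a - 2 * a ^ 2 + 2 * a ^ 3) / 48"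
    and "erw_law a 3 3 = (18 + 4 * a - 14 * a ^ 2 - 8 * a ^ 3) / 48"
    and "erw_law a 3 4 = (6 + 18 * a + 18 * a ^ 2 + 6 * a ^ 3) / 48"
proof -
  have step: "erw_law a 3 k =
    (3 + (3 * a - 2 * a * k)) / 6 * erw_law a 2 k +
    (3 - (3 * a - 2 * a * (k - 1))) / 6 * erw_law a 2 (k - 1)" for k
    using erw_law.simps(2)[of a 2 k] by (simp add: erw_weight_def field_simps eval_nat_numeral)
  show "erw_law a 3 1 = (6 - 4 * a - 2 * a ^ 2) / 48"
    unfolding step[of 1]
    by (simp add: erw_law_2 erw_law_eq_0) (simp add: field_simps power_numeral_reduce)?
  show "erw_law a 3 2 = (18 - 18 * a - 2 * a ^ 2 + 2 * a ^ 3) / 48"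
    unfolding step[of 2]
    by (simp add: erw_law_2 erw_law_eq_0) (simp add: field_simps power_numeral_reduce)?
  show "erw_law a 3 3 = (18 + 4 * a - 14 * a ^ 2 - 8 * a ^ 3) / 48"
    unfolding step[of 3]
    by (simp add: erw_law_2 erw_law_eq_0) (simp add: field_simps power_numeral_reduce)?
  show "erw_law a 3 4 = (6 + 18 * a + 18 * a ^ 2 + 6 * a ^ 3) / 48"
    unfolding step[of 4]
    by (simp add: erw_law_2 erw_law_eq_0) (simp add: field_simps power_numeral_reduce)?
qed

lemma erw_law_4:
  fixes a :: real
  shows "erw_law a 4 1 = (24 - 4 * a - 16 * a ^ 2 - 4 * a ^ 3) / 384"
    and "erw_law a 4 2 = (96 - 100 * a - 8 * a ^ 2 + 12 * a ^ 3) / 384"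
    and "erw_law a 4 3 = (144 - 92 * a - 72 * a ^ 2 + 4 * a ^ 3 + 16 * a ^ 4) / 384"
    and "erw_law a 4 4 = (96 + 100 * a - 48 * a ^ 2 - 108 * a ^ 3 - 40 * a ^ 4) / 384"
    and "erw_law a 4 5 = (24 + 96 * a + 144 * a ^ 2 + 96 * a ^ 3 + 24 * a ^ 4) / 384"
proof -
  have step: "erw_law a 4 k =
    (4 + (4 * a - 2 * a * k)) / 8 * erw_law a 3 k +
    (4 - (4 * a - 2 * a * (k - 1))) / 8 * erw_law a 3 (k - 1)" for k
    using erw_law.simps(2)[of a 3 k] by (simp add: erw_weight_def field_simps eval_nat_numeral)
  show "erw_law a 4 1 = (24 - 4 * a - 16 * a ^ 2 - 4 * a ^ 3) / 384"
    unfolding step[of 1]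
    by (simp add: erw_law_3 erw_law_eq_0) (simp add: field_simps power_numeral_reduce)?
  show "erw_law a 4 2 = (96 - 100 * a - 8 * a ^ 2 + 12 * a ^ 3) / 384"
    unfolding step[of 2]
    by (simp add: erw_law_3 erw_law_eq_0) (simp add: field_simps power_numeral_reduce)?
  show "erw_law a 4 3 = (144 - 92 * a - 72 * a ^ 2 + 4 * a ^ 3 + 16 * a ^ 4) / 384"
    unfolding step[of 3]
    by (simp add: erw_law_3 erw_law_eq_0) (simp add: field_simps power_numeral_reduce)?
  show "erw_law a 4 4 = (96 + 100 * a - 48 * a ^ 2 - 108 * a ^ 3 - 40 * a ^ 4) / 384"
    unfolding step[of 4]
    by (simp add: erw_law_3 erw_law_eq_0) (simp add: field_simps power_numeral_reduce)?
  show "erw_law a 4 5 = (24 + 96 * a + 144 * a ^ 2 + 96 * a ^ 3 + 24 * a ^ 4) / 384"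
    unfolding step[of 5]
    by (simp add: erw_law_3 erw_law_eq_0) (simp add: field_simps power_numeral_reduce)?
qed

text \<open>The hypothesis \<open>\<delta> \<le> b * d\<close> of \<open>lc_step_ineq\<close> holds for all weights only from time \<open>5\<close> (\<open>n = 4\<close>)
  on, hence the explicit base case.\<close>

lemma erw_law_4_lc:
  fixes a :: real
  assumes "1 / 2 \<le> a" "a \<le> 62 / 100" "1 < k" "k < 5"
  shows "erw_law a 4 (k - 1) * erw_law a 4 (k + 1) \<le> (erw_law a 4 k)\<^sup>2"
proof -
  \<comment> \<open>These bounds let linear arithmetic treat the powers of \<open>a\<close> as
    independent variables in a box, which is enough for all three cofactors below.\<close>
  have p: "0 \<le> a ^ i" "a ^ i \<le> (62 / 100) ^ i" for i
    using assms power_mono[of a "62 / 100" i] by auto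
  note up = p(2)[of 2] p(2)[of 3] p(2)[of 4] p(2)[of 5] p(2)[of 6] p(2)[of 7]
  note lo = p(1)[of 2] p(1)[of 3] p(1)[of 4] p(1)[of 5] p(1)[of 6] p(1)[of 7]
  have clear: "y / 384 * (z / 384) \<le> (x / 384)\<^sup>2" if "0 \<le> x\<^sup>2 - y * z" for x y z :: real
    using that by (simp add: power_divide power2_eq_square)
  consider "k = 2" | "k = 3" | "k = 4" using assms by linarith
  then show ?thesis
  proof cases
    case 1
    have "0 \<le> 1920 - 2272 * a - 384 * a ^ 2 + 352 * a ^ 3 + 64 * a ^ 4"
      using up lo assms by (simp add: power_divide)
    \<comment> \<open>At \<open>a = 1\<close> every step is up and all masses but the top one
      vanish. This accounts for the factor \<open>(1 - a)\<^sup>2\<close> here and for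
      \<open>k = 3\<close>, and for the single \<open>1 - a\<close> for \<open>k = 4\<close>, where
      the top mass occurs.\<close>
    then have "0 \<le> ((1 - a)\<^sup>2 * (a + 3)) * (1920 - 2272 * a - 384 * a ^ 2 + 352 * a ^ 3 + 64 * a ^ 4)"
      using assms by (intro mult_nonneg_nonneg) auto
    also have "\<dots> = (96 - 100 * a - 8 * a ^ 2 + 12 * a ^ 3)\<^sup>2
        - (24 - 4 * a - 16 * a ^ 2 - 4 * a ^ 3) * (144 - 92 * a - 72 * a ^ 2 + 4 * a ^ 3 + 16 * a ^ 4)"
      by algebra
    finally show ?thesis
      using 1 clear by (simp add: erw_law_4)
  next
    case 2
    have "0 \<le> 11520 - 3456 * a - 15328 * a ^ 2 - 7584 * a ^ 3 + 672 * a ^ 4 + 1120 * a ^ 5 + 256 * a ^ 6"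
      using up lo assms by (simp add: power_divide)
    then have "0 \<le> (1 - a)\<^sup>2 *
        (11520 - 3456 * a - 15328 * a ^ 2 - 7584 * a ^ 3 + 672 * a ^ 4 + 1120 * a ^ 5 + 256 * a ^ 6)"
      by (intro mult_nonneg_nonneg) auto
    also have "\<dots> = (144 - 92 * a - 72 * a ^ 2 + 4 * a ^ 3 + 16 * a ^ 4)\<^sup>2
        - (96 - 100 * a - 8 * a ^ 2 + 12 * a ^ 3) * (96 + 100 * a - 48 * a ^ 2 - 108 * a ^ 3 - 40 * a ^ 4)"
      by algebra
    finally show ?thesis
      using 2 clear by (simp add: erw_law_4)
  next
    case 3
    have "(1 / 2)\<^sup>2 \<le> a\<^sup>2"
      using assms by (intro power_mono) auto
    then have "0 \<le> 5760 + 13344 * a + 3952 * a ^ 2 - 20144 * a ^ 3 - 32144 * a ^ 4 - 22768 * a ^ 5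
        - 8224 * a ^ 6 - 1216 * a ^ 7"
      using up assms by (simp add: power_divide)
    then have "0 \<le> (1 - a) *
       (5760 + 13344 * a + 3952 * a ^ 2 - 20144 * a ^ 3 - 32144 * a ^ 4 - 22768 * a ^ 5
        - 8224 * a ^ 6 - 1216 * a ^ 7)"
      using assms by (intro mult_nonneg_nonneg) auto
    also have "\<dots> = (96 + 100 * a - 48 * a ^ 2 - 108 * a ^ 3 - 40 * a ^ 4)\<^sup>2
        - (144 - 92 * a - 72 * a ^ 2 + 4 * a ^ 3 + 16 * a ^ 4) * (24 + 96 * a + 144 * a ^ 2 + 96 * a ^ 3 + 24 * a ^ 4)"
      by algebra
    finally show ?thesis
      using 3 clear by (simp add: erw_law_4)
  qed
qed

lemma lc_seq_erw_law:
  assumes a: "1 / 2 \<le> a" "a\<^sup>2 + a \<le> 1" and "4 \<le> n"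
  shows "lc_seq (erw_law a n)"
  using assms(3)
proof (induction n rule: dec_induct)
  have "a \<le> 62 / 100"
  proof (rule ccontr)
    assume gt: "\<not> ?thesis"
    then have "(62 / 100)\<^sup>2 \<le> a\<^sup>2" by (intro power_mono) auto
    then show False using a gt by (simp add: power2_eq_square)
  qed
  moreover case base
  ultimately show ?case
    using a erw_law_4_lc[of a] by (intro lc_seqI[where u = 1 and v = 5] erw_law_pos erw_law_eq_0) auto
next
  case (step n)
  have "a < 1"
  proof (rule ccontr)
    assume "\<not> ?thesis"
    then have "1 \<le> a\<^sup>2" by (intro one_le_power) auto
    then show False using a by linarith
  qed
  show ?case
  proof (rule lc_seqI[where u = 1 and v = "int n + 2"])
    fix k :: int
    assume k: "1 < k" "k < int n + 2"
    define f where "f = erw_law a n"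
    define \<delta> where "\<delta> = a / real (Suc n)"
    define b where "b = erw_weight a n (k - 1)"
    define d where "d = 1 - erw_weight a n k"
    define \<alpha> where "\<alpha> = (1 - a) / 2"
    have bd: "b + d = 1 - \<delta>"
      by (simp add: b_def d_def \<delta>_def erw_weight_pred)
    have w: "erw_weight a n (k - 2) = b - \<delta>" "erw_weight a n k = b + \<delta>"
      "1 - erw_weight a n (k - 1) = d + \<delta>" "1 - erw_weight a n (k + 1) = d - \<delta>"
      using erw_weight_pred[of a n "k - 1"] erw_weight_pred[of a n k] erw_weight_pred[of a n "k + 1"]
      by (simp_all add: b_def d_def \<delta>_def)
    have "\<alpha> \<le> b"
      using k a erw_weight_bounds(1)[of a "k - 1" n] by (simp add: b_def \<alpha>_def)
    have "\<alpha> \<le> d"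
      using k a erw_weight_bounds(2)[of a k n] by (simp add: d_def \<alpha>_def field_simps)
    have "\<delta> \<le> b * d"
    proof -
      \<comment> \<open>The 5 is the least value of \<open>n + 1\<close>, and
        \<open>1 + \<alpha> \<le> 5 / 4\<close> because \<open>a \<ge> 1 / 2\<close>. What remains
        is \<open>a / 4 \<le> \<alpha> * (1 - \<alpha>) = (1 - a\<^sup>2) / 4\<close>, which is
        \<open>a\<^sup>2 + a \<le> 1\<close>.\<close>
      have "\<delta> \<le> a / 5"
        using a step unfolding \<delta>_def by (intro divide_left_mono) auto
      then have "\<delta> * (1 + \<alpha>) \<le> a / 5 * (1 + \<alpha>)"
        using \<open>a < 1\<close> by (intro mult_right_mono) (auto simp: \<alpha>_def)
      also have "\<dots> \<le> a / 5 * (5 / 4)"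
        using a by (intro mult_left_mono) (auto simp: \<alpha>_def)
      also have "\<dots> \<le> \<alpha> * (1 - \<alpha>)"
        using a by (simp add: \<alpha>_def field_simps power2_eq_square)
      also have "\<dots> = \<alpha> * (b + d) - \<alpha>\<^sup>2 + \<alpha> * \<delta>"
        unfolding bd by (simp add: algebra_simps power2_eq_square)
      finally have "\<delta> \<le> \<alpha> * (b + d) - \<alpha>\<^sup>2"
        by (simp add: algebra_simps)
      \<comment> \<open>For a given sum \<open>b + d\<close>, the product is smallest when one of
        the two equals its lower bound \<open>\<alpha>\<close>.\<close>
      also have "\<dots> \<le> b * d"
        using mult_nonneg_nonneg[of "b - \<alpha>" "d - \<alpha>"] \<open>\<alpha> \<le> b\<close> \<open>\<alpha> \<le> d\<close>
        by (simp add: algebra_simps power2_eq_square)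
      finally show ?thesis .
    qed
    have lc: "f i * f l \<le> f j * f (i + l - j)" if "i \<le> j" "i \<le> i + l - j" for i j l
      using lc_seqD_shift[OF step.IH, of i j "i + l - j" l] that by (simp add: f_def)
    have "erw_law a (Suc n) (k - 1) = (d + \<delta>) * f (k - 1) + (b - \<delta>) * f (k - 2)"
      "erw_law a (Suc n) (k + 1) = (d - \<delta>) * f (k + 1) + (b + \<delta>) * f k"
      "erw_law a (Suc n) k = d * f k + b * f (k - 1)"
      using w by (simp_all add: erw_law.simps(2) f_def d_def b_def)
    moreover have "f (k - 2) * f k \<le> (f (k - 1))\<^sup>2" "f (k - 1) * f (k + 1) \<le> (f k)\<^sup>2"
      "f (k - 2) * f (k + 1) \<le> f (k - 1) * f k"
      using lc[of "k - 2" "k - 1" k] lc[of "k - 1" k "k + 1"] lc[of "k - 2" "k - 1" "k + 1"]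
      by (simp_all add: power2_eq_square)
    then have "((d + \<delta>) * f (k - 1) + (b - \<delta>) * f (k - 2)) * ((d - \<delta>) * f (k + 1) + (b + \<delta>) * f k)
        \<le> (d * f k + b * f (k - 1))\<^sup>2"
      using bd \<open>\<delta> \<le> b * d\<close> a \<open>a < 1\<close>
      by (intro lc_step_ineq) (auto simp: f_def erw_law_nonneg mult.commute)
    ultimately show "erw_law a (Suc n) (k - 1) * erw_law a (Suc n) (k + 1) \<le> (erw_law a (Suc n) k)\<^sup>2"
      by simp
  qed (use a \<open>a < 1\<close> in \<open>auto intro!: erw_law_pos erw_law_eq_0\<close>)
qed

section \<open>Distribution functions with log-concave increments\<close>

text \<open>For fixed \<open>x\<close> and \<open>y\<close>, the set of weights satisfying the
  inequality is closed under averaging, so it contains the dyadic weights in the unit interval;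
  continuity of \<open>g\<close> reaches the others.\<close>

lemma log_concave_if_midpoint:
  fixes g :: "real \<Rightarrow> real"
  assumes cont: "continuous_on UNIV g" and nonneg: "\<And>x. 0 \<le> g x"
    and mid: "\<And>x y. g x * g y \<le> (g ((x + y) / 2))\<^sup>2"
  shows "log_concave g"
  unfolding log_concave_def
proof (intro conjI allI impI)
  fix x y l :: real
  assume l: "0 < l \<and> l < 1"
  define P where "P t \<longleftrightarrow> g x powr t * g y powr (1 - t) \<le> g (t * x + (1 - t) * y)" for t
  have half: "P ((s + t) / 2)" if "P s" "P t" for s t
  proof -
    define u where "u = s * x + (1 - s) * y"
    define v where "v = t * x + (1 - t) * y"
    have "(g x powr ((s + t) / 2) * g y powr (1 - (s + t) / 2))\<^sup>2
      = (g x powr s * g y powr (1 - s)) * (g x powr t * g y powr (1 - t))"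
    proof -
      have "(g x powr ((s + t) / 2))\<^sup>2 = g x powr s * g x powr t"
        by (simp add: power2_eq_square flip: powr_add)
      moreover have "(g y powr (1 - (s + t) / 2))\<^sup>2 = g y powr (1 - s) * g y powr (1 - t)"
        by (simp add: power2_eq_square flip: powr_add)
      ultimately show ?thesis by (simp add: power_mult_distrib)
    qed
    also have "\<dots> \<le> g u * g v"
      using that unfolding P_def u_def v_def by (intro mult_mono) (auto simp: nonneg)
    also have "\<dots> \<le> (g ((u + v) / 2))\<^sup>2"
      by (rule mid)
    finally have "g x powr ((s + t) / 2) * g y powr (1 - (s + t) / 2) \<le> g ((u + v) / 2)"
      by (rule power2_le_imp_le) (rule nonneg)
    moreover have "(u + v) / 2 = (s + t) / 2 * x + (1 - (s + t) / 2) * y"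
      by (simp add: u_def v_def field_simps)
    ultimately show ?thesis by (simp add: P_def)
  qed
  \<comment> \<open>Since \<open>0 powr 0 = 0\<close>, the end points cause no trouble where
    \<open>g\<close> vanishes.\<close>
  have "P 0" "P 1"
    using nonneg[of x] nonneg[of y] by (auto simp: P_def)
  have dyadic: "P (real j / 2 ^ n)" if "j \<le> 2 ^ n" for j n :: nat
    using that
  proof (induction n arbitrary: j)
    case 0
    then show ?case using \<open>P 0\<close> \<open>P 1\<close> by (cases j) auto
  next
    case (Suc n)
    have "P ((real (j div 2) / 2 ^ n + real (j - j div 2) / 2 ^ n) / 2)"
      using Suc.prems by (intro half Suc.IH) auto
    moreover have "(real (j div 2) / 2 ^ n + real (j - j div 2) / 2 ^ n) / 2 = real j / 2 ^ Suc n"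
      by (simp add: field_simps of_nat_diff)
    ultimately show ?case by (simp only:)
  qed
  define r where "r n = real (nat \<lfloor>l * 2 ^ n\<rfloor>) / 2 ^ n" for n
  have "P (r n)" for n
  proof -
    have "l * 2 ^ n \<le> 1 * 2 ^ n" using l by (intro mult_right_mono) auto
    then have "\<lfloor>l * 2 ^ n\<rfloor> \<le> \<lfloor>2 ^ n :: real\<rfloor>" by (intro floor_mono) simp
    then show ?thesis
      unfolding r_def by (intro dyadic) (simp add: nat_le_iff)
  qed
  have r_lim: "r \<longlonglongrightarrow> l"
  proof (rule tendsto_sandwich)
    show "\<forall>\<^sub>F n in sequentially. l - (1 / 2) ^ n \<le> r n"
    proof (intro always_eventually allI)
      fix n
      have "l * 2 ^ n - 1 \<le> real (nat \<lfloor>l * 2 ^ n\<rfloor>)"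
        using l by linarith
      then have "(l * 2 ^ n - 1) / 2 ^ n \<le> r n"
        unfolding r_def by (intro divide_right_mono) auto
      then show "l - (1 / 2) ^ n \<le> r n"
        by (simp add: diff_divide_distrib power_divide)
    qed
    show "\<forall>\<^sub>F n in sequentially. r n \<le> l"
      using l by (auto simp: r_def field_simps)
    have "(\<lambda>n. l - (1 / 2) ^ n) \<longlonglongrightarrow> l - 0"
      by (intro tendsto_intros LIMSEQ_power_zero) auto
    then show "(\<lambda>n. l - (1 / 2) ^ n) \<longlonglongrightarrow> l" by simp
  qed auto
  show "g x powr l * g y powr (1 - l) \<le> g (l * x + (1 - l) * y)"
  proof (cases "g x = 0 \<or> g y = 0")
    case False
    show ?thesis
    proof (rule LIMSEQ_le)
      show "(\<lambda>n. g x powr r n * g y powr (1 - r n)) \<longlonglongrightarrow> g x powr l * g y powr (1 - l)"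
        using False r_lim by (intro tendsto_intros) auto
      show "(\<lambda>n. g (r n * x + (1 - r n) * y)) \<longlonglongrightarrow> g (l * x + (1 - l) * y)"
        using cont by (intro continuous_on_tendsto_compose[where s = UNIV and f = g] tendsto_intros r_lim) auto
      show "\<exists>N. \<forall>n\<ge>N. g x powr r n * g y powr (1 - r n) \<le> g (r n * x + (1 - r n) * y)"
        using \<open>\<And>n. P (r n)\<close> by (auto simp: P_def)
    qed
  qed (use nonneg in auto)
qed (rule nonneg)

text \<open>A weighted geometric mean is at least the smaller of its two terms.\<close>

lemma log_concave_min_le:
  assumes "log_concave g" "x \<le> z" "z \<le> y"
  shows "min (g x) (g y) \<le> g z"
proof (cases "x < z \<and> z < y")
  case True
  define l where "l = (y - z) / (y - x)"
  have l: "0 < l" "l < 1" using True by (auto simp: l_def field_simps)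
  have nonneg: "0 \<le> g t" for t using assms by (auto simp: log_concave_def)
  have "l * x + (1 - l) * y = y - l * (y - x)" by (simp add: algebra_simps)
  then have z: "l * x + (1 - l) * y = z" using True by (simp add: l_def)
  define m where "m = min (g x) (g y)"
  have m: "0 \<le> m" "m \<le> g x" "m \<le> g y" using nonneg by (auto simp: m_def)
  have "m = m powr l * m powr (1 - l)"
    using m by (simp flip: powr_add)
  also have "\<dots> \<le> g x powr l * g y powr (1 - l)"
    using m l by (intro mult_mono powr_mono2) auto
  also have "\<dots> \<le> g z"
    using assms(1) l z unfolding log_concave_def by metis
  finally show ?thesis by (simp add: m_def)
qed (use assms in \<open>auto simp: not_less\<close>)

text \<open>Unimodality: a rise from \<open>y\<close> to \<open>z\<close> after the drop would leave
  a value, at \<open>v\<close> or at \<open>y\<close>, below the smaller of two values on either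
  side of it.\<close>

lemma log_concave_antimono_after_drop:
  assumes "log_concave g" "u < v" "g v < g u" "v \<le> y" "y \<le> z"
  shows "g z \<le> g y"
proof (rule ccontr)
  assume "\<not> ?thesis"
  moreover have "min (g u) (g z) \<le> g v" "min (g v) (g z) \<le> g y"
    using assms by (auto intro!: log_concave_min_le[OF assms(1)] simp del: min_le_iff_disj)
  ultimately show False using assms(3) by linarith
qed

lemma log_concave_scale:
  assumes "log_concave g" "0 < c"
  shows "log_concave (\<lambda>x. c * g x)"
  unfolding log_concave_def
proof (intro conjI allI impI)
  show "0 \<le> c * g x" for x using assms by (simp add: log_concave_def)
  fix x y l :: real assume l: "0 < l \<and> l < 1"
  have "(c * g x) powr l * (c * g y) powr (1 - l) = c powr (l + (1 - l)) * (g x powr l * g y powr (1 - l))"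
    using assms unfolding powr_add by (simp add: powr_mult log_concave_def)
  also have "\<dots> \<le> c * g (l * x + (1 - l) * y)"
    using assms l by (auto simp: log_concave_def)
  finally show "(c * g x) powr l * (c * g y) powr (1 - l) \<le> c * g (l * x + (1 - l) * y)" .
qed

lemma log_concave_lim:
  assumes "\<And>k::nat. log_concave (f k)" "\<And>x. (\<lambda>k. f k x) \<longlonglongrightarrow> g x"
  shows "log_concave g"
  unfolding log_concave_def
proof (intro conjI allI impI)
  show "0 \<le> g x" for x
    using assms(1) by (intro LIMSEQ_le_const[OF assms(2)]) (auto simp: log_concave_def)
  fix x y l :: real assume l: "0 < l \<and> l < 1"
  show "g x powr l * g y powr (1 - l) \<le> g (l * x + (1 - l) * y)"
  proof (rule LIMSEQ_le[OF _ assms(2)])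
    \<comment> \<open>The limits may be 0; \<open>tendsto_powr'\<close> covers that case because
      both exponents are positive.\<close>
    show "(\<lambda>k. f k x powr l * f k y powr (1 - l)) \<longlonglongrightarrow> g x powr l * g y powr (1 - l)"
      using assms(1) l
      by (intro tendsto_mult tendsto_powr' assms(2) tendsto_const disjI2) (auto simp: log_concave_def)
    show "\<exists>N. \<forall>k\<ge>N. f k x powr l * f k y powr (1 - l) \<le> f k (l * x + (1 - l) * y)"
      using assms(1) l by (auto simp: log_concave_def)
  qed
qed

text \<open>By \<open>D_split\<close>, passing from scale \<open>k\<close> to \<open>k + 1\<close>
  raises the quotient at \<open>x\<close> when \<open>D (Suc k)\<close> does not rise from
  \<open>x\<close> to \<open>x + h (Suc k)\<close>, and lowers it when it does not drop. The point
  is that one alternative eventually prevails. The set \<open>W\<close> of points to the right of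
  which no scale ever rises is closed upwards: in \<open>W\<close> the quotients increase, outside
  they eventually decrease.\<close>

lemma dyadic_difference_quotients_convergent:
  fixes F :: "real \<Rightarrow> real" and C :: real
  defines "D \<equiv> \<lambda>k x. F (x + 1 / 2 ^ k) - F x"
  assumes lc: "\<And>k. log_concave (D k)" and cont: "continuous_on UNIV F"
    and lip: "\<And>k x. 2 ^ k * D k x \<le> C"
  shows "convergent (\<lambda>k. 2 ^ k * D k x)"
proof -
  define h where "h k = (1 / 2 ^ k :: real)" for k :: nat
  have h: "0 < h k" "h k = 2 * h (Suc k)" for k by (auto simp: h_def)
  have D_pos: "0 \<le> D k x" for k x using lc by (simp add: log_concave_def)
  have D_eq: "D k y = F (y + h k) - F y" for k y by (simp add: D_def h_def)
  have D_split: "D k x = D (Suc k) x + D (Suc k) (x + h (Suc k))" for k x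
  proof -
    have eq: "x + h (Suc k) + h (Suc k) = x + h k" using h(2)[of k] by simp
    show ?thesis unfolding D_eq eq by simp
  qed
  define A where "A z k \<longleftrightarrow> (\<forall>y t. z \<le> y \<longrightarrow> 0 \<le> t \<longrightarrow> D k (y + t) \<le> D k y)" for z k
  define W where "W = {z. \<forall>k. A z k}"
  have A_pred: "A z k" if "A z (Suc k)" for z k
    unfolding A_def
  proof (intro allI impI)
    fix y t :: real assume yt: "z \<le> y" "0 \<le> t"
    have eq: "y + t + h (Suc k) = y + h (Suc k) + t" by simp
    have "D (Suc k) (y + t) \<le> D (Suc k) y"
      "D (Suc k) (y + h (Suc k) + t) \<le> D (Suc k) (y + h (Suc k))"
      using that yt h(1)[of "Suc k"] unfolding A_def by simp_all
    then show "D k (y + t) \<le> D k y"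
      unfolding D_split[of k] eq by linarith
  qed
  have A_mono: "A z' k" if "z \<le> z'" "A z k" for z z' k
    using that unfolding A_def by (meson order_trans)
  have coarser: "A z k" if "k \<le> j" "A z j" for z j k
    using that by (induction rule: inc_induct) (auto intro: A_pred)
  \<comment> \<open>A drop between adjacent cells survives refinement within the same two cells: of
    the four half-cells the first two outweigh the last two, so their values cannot be
    nondecreasing.\<close>
  have drop: "\<exists>u. x \<le> u \<and> u + 2 * h j \<le> x + 2 * h k \<and> D j (u + h j) < D j u"
    if "D k (x + h k) < D k x" "k \<le> j" for k j x
    using that(2)
  proof (induction rule: dec_induct)
    case base
    then show ?case using that by auto
  next
    case (step j)
    then obtain u where u: "x \<le> u" "u + 2 * h j \<le> x + 2 * h k" "D j (u + h j) < D j u"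
      by auto
    define e where "e = h (Suc j)"
    have e: "h j = 2 * e" "0 < e" using h(2)[of j] h(1)[of "Suc j"] by (auto simp: e_def)
    have eq: "u + h j = u + 2 * e" "u + 2 * e + h (Suc j) = u + 3 * e" "u + h (Suc j) = u + e"
      using e by (auto simp: e_def)
    have "D (Suc j) (u + 2 * e) + D (Suc j) (u + 3 * e) < D (Suc j) u + D (Suc j) (u + e)"
      using u(3) unfolding eq D_split[of j] by simp
    then have "D (Suc j) (u + e) < D (Suc j) u \<or> D (Suc j) (u + 2 * e) < D (Suc j) (u + e) \<or>
        D (Suc j) (u + 3 * e) < D (Suc j) (u + 2 * e)"
      by linarith
    moreover have "u + 2 * e = u + e + e" "u + 3 * e = u + 2 * e + e"
      by simp_all
    ultimately obtain v where v: "v = u \<or> v = u + e \<or> v = u + 2 * e" "D (Suc j) (v + e) < D (Suc j) v"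
      by metis
    then show ?case
      using u e by (intro exI[of _ v]) (auto simp flip: e_def)
  qed
  \<comment> \<open>The drop is found again at scale \<open>max i k\<close>, where unimodality
    forbids later rises; \<open>coarser\<close> carries this back to scale \<open>i\<close>.\<close>
  have W_drop: "x + 2 * h k \<in> W" if dr: "D k (x + h k) < D k x" for k x
  proof -
    have "A (x + 2 * h k) i" for i
    proof (rule coarser[of i "max i k"])
      obtain u where u: "u + 2 * h (max i k) \<le> x + 2 * h k"
          "D (max i k) (u + h (max i k)) < D (max i k) u"
        using drop[OF dr, of "max i k"] by auto
      show "A (x + 2 * h k) (max i k)"
        unfolding A_def
      proof (intro allI impI)
        fix y t :: real assume "x + 2 * h k \<le> y" "0 \<le> t"
        then show "D (max i k) (y + t) \<le> D (max i k) y"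
          using u h(1)[of "max i k"]
          by (intro log_concave_antimono_after_drop[OF lc, of u "u + h (max i k)"]) auto
      qed
    qed simp
    then show ?thesis by (auto simp: W_def)
  qed
  show ?thesis
  proof (cases "x \<in> W")
    case True
    have "incseq (\<lambda>k. 2 ^ k * D k x)"
    proof (rule incseq_SucI)
      fix k
      have "D (Suc k) (x + h (Suc k)) \<le> D (Suc k) x"
        using True h(1)[of "Suc k"] by (auto simp: W_def A_def less_imp_le)
      then show "2 ^ k * D k x \<le> 2 ^ Suc k * D (Suc k) x"
        using D_split[of k x] by simp
    qed
    then obtain L where "(\<lambda>k. 2 ^ k * D k x) \<longlonglongrightarrow> L"
      by (rule incseq_convergent[of _ C]) (simp add: lip)
    then show ?thesis by (rule convergentI)
  next
    case False
    then obtain k y t where y: "x \<le> y" "0 \<le> t" "D k y < D k (y + t)"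
      by (auto simp: W_def A_def not_le)
    \<comment> \<open>The strict rise at \<open>y\<close> persists slightly to the right of
      \<open>y\<close>, so some \<open>x + e\<close> with \<open>e > 0\<close> is outside
      \<open>W\<close> too.\<close>
    have "continuous_on UNIV (\<lambda>e. D k (y + e + t) - D k (y + e))"
      unfolding D_def by (intro continuous_intros continuous_on_compose2[OF cont]) auto
    then have "isCont (\<lambda>e. D k (y + e + t) - D k (y + e)) 0"
      by (simp add: continuous_on_eq_continuous_at)
    then have "(\<lambda>j. D k (y + (1 / 2) ^ j + t) - D k (y + (1 / 2) ^ j)) \<longlonglongrightarrow> D k (y + 0 + t) - D k (y + 0)"
      by (intro isCont_tendsto_compose[where g = "\<lambda>e. D k (y + e + t) - D k (y + e)"] LIMSEQ_power_zero) auto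
    then have "\<forall>\<^sub>F j in sequentially. 0 < D k (y + (1 / 2) ^ j + t) - D k (y + (1 / 2) ^ j)"
      by (rule order_tendstoD) (use y in simp)
    then obtain j where j: "0 < D k (y + (1 / 2) ^ j + t) - D k (y + (1 / 2) ^ j)"
      using eventually_happens'[OF sequentially_bot] by blast
    define e :: real where "e = (1 / 2) ^ j"
    have e: "0 < e" "D k (y + e) < D k (y + e + t)"
      using j by (simp_all add: e_def)
    have "\<not> A (x + e) k"
    proof
      assume "A (x + e) k"
      then have "D k (y + e + t) \<le> D k (y + e)" using y by (simp add: A_def)
      then show False using e by simp
    qed
    then have notW: "z \<notin> W" if "z \<le> x + e" for z
      using A_mono[OF that] by (auto simp: W_def)
    have "h \<longlonglongrightarrow> 0"
      unfolding h_def using LIMSEQ_power_zero[of "1 / 2 :: real"] by (simp add: power_divide)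
    then have "\<forall>\<^sub>F k in sequentially. h k < e / 2"
      by (rule order_tendstoD) (use e in simp)
    then obtain N where N: "\<And>k. k \<ge> N \<Longrightarrow> h k < e / 2"
      by (auto simp: eventually_sequentially)
    \<comment> \<open>From index \<open>N\<close> on, \<open>x + 2 * h k\<close> stays below
      \<open>x + e\<close> and hence outside \<open>W\<close>, so by \<open>W_drop\<close> no such
      scale drops at \<open>x\<close>.\<close>
    have "decseq (\<lambda>k. 2 ^ (k + N) * D (k + N) x)"
    proof (rule decseq_SucI)
      fix k
      have "D (Suc (k + N)) x \<le> D (Suc (k + N)) (x + h (Suc (k + N)))"
        using W_drop[of "Suc (k + N)" x] notW[of "x + 2 * h (Suc (k + N))"] N[of "Suc (k + N)"] by force
      then show "2 ^ (Suc k + N) * D (Suc k + N) x \<le> 2 ^ (k + N) * D (k + N) x"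
        using D_split[of "k + N" x] by simp
    qed
    then obtain L where "(\<lambda>k. 2 ^ (k + N) * D (k + N) x) \<longlonglongrightarrow> L"
      by (rule decseq_convergent[of _ 0]) (simp add: D_pos)
    then have "convergent (\<lambda>k. 2 ^ (k + N) * D (k + N) x)"
      by (rule convergentI)
    then show ?thesis
      using convergent_ignore_initial_segment[of "\<lambda>k. 2 ^ k * D k x" N] by simp
  qed
qed

text \<open>The integral of a difference quotient over \<open>{a..b}\<close> telescopes to an
  average of \<open>F\<close> just after \<open>b\<close> minus one just after \<open>a\<close>. By
  continuity this tends to \<open>F b - F a\<close>, while the Lipschitz constant dominates the
  quotients.\<close>

lemma lebesgue_density_of_log_concave_increments:
  fixes F :: "real \<Rightarrow> real"
  assumes mono: "mono F" and bot: "(F \<longlongrightarrow> 0) at_bot"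
    and lip: "\<And>x h. 0 \<le> h \<Longrightarrow> F (x + h) - F x \<le> C * h"
    and mid: "\<And>h x y. 0 < h \<Longrightarrow>
      (F (x + h) - F x) * (F (y + h) - F y) \<le> (F ((x + y) / 2 + h) - F ((x + y) / 2))\<^sup>2"
  shows "\<exists>f. f \<in> borel_measurable borel \<and> log_concave f \<and>
    (\<forall>b. (\<integral>\<^sup>+x. ennreal (f x) * indicator {..b} x \<partial>lborel) = ennreal (F b))"
proof -
  have incr: "0 \<le> F (x + h) - F x" if "0 \<le> h" for x h
    using monoD[OF mono, of x "x + h"] that by simp
  have "0 \<le> C"
    using incr[of 1 0] lip[of 1 0] by simp
  have "C-lipschitz_on UNIV F"
  proof (rule lipschitz_onI)
    fix x y :: real
    show "dist (F x) (F y) \<le> C * dist x y"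
      using incr[of "x - y" y] lip[of "x - y" y] incr[of "y - x" x] lip[of "y - x" x]
      by (cases "x \<le> y") (auto simp: dist_real_def abs_if)
  qed (rule \<open>0 \<le> C\<close>)
  then have cont: "continuous_on UNIV F"
    by (rule lipschitz_on_continuous_on)
  have contI: "continuous_on A (\<lambda>x. F (x + c))" for A c
    by (intro continuous_on_compose2[OF cont] continuous_intros) auto
  define h where "h k = (1 / 2 ^ k :: real)" for k :: nat
  have h: "0 < h k" "2 ^ k * h k = 1" for k by (auto simp: h_def)
  have h_lim: "h \<longlonglongrightarrow> 0"
    unfolding h_def using LIMSEQ_power_zero[of "1 / 2 :: real"] by (simp add: power_divide)
  define f where "f k x = 2 ^ k * (F (x + h k) - F x)" for k x
  have f_bounds: "0 \<le> f k x" "f k x \<le> C" for k x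
    using incr[of "h k" x] mult_left_mono[OF lip[of "h k" x], of "2 ^ k"] h[of k]
    by (simp_all add: f_def mult.left_commute[of _ C])
  have lc: "log_concave (\<lambda>x. F (x + h k) - F x)" for k
    using incr[of "h k"] h(1)[of k] mid
    by (intro log_concave_if_midpoint continuous_intros contI continuous_on_subset[OF cont]) auto
  have "convergent (\<lambda>k. f k x)" for x
    unfolding f_def h_def
    using lc f_bounds(2) by (intro dyadic_difference_quotients_convergent[OF _ cont]) (auto simp: f_def h_def)
  then obtain g where g: "\<And>x. (\<lambda>k. f k x) \<longlonglongrightarrow> g x"
    unfolding convergent_def by metis
  have f_cont: "continuous_on A (f k)" for A k
    unfolding f_def by (intro continuous_intros contI continuous_on_subset[OF cont]) auto
  have "f k \<in> borel_measurable borel" for k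
    by (rule borel_measurable_continuous_onI[OF f_cont])
  then have g_meas: "g \<in> borel_measurable borel"
    by (rule borel_measurable_LIMSEQ_real[rotated]) (rule g)
  have g_lc: "log_concave g"
  proof (rule log_concave_lim[OF _ g])
    show "log_concave (f k)" for k
      unfolding f_def by (intro log_concave_scale lc) auto
  qed
  have g_int: "(g has_integral F b - F a) {a..b}" if "a \<le> b" for a b
  proof -
    have int_F: "F integrable_on {u..v}" for u v
      by (intro integrable_continuous_interval continuous_on_subset[OF cont]) auto
    have sandwich: "h k * F u \<le> integral {u..u + h k} F" "integral {u..u + h k} F \<le> h k * F (u + h k)" for u k
    proof -
      have "integral {u..u + h k} (\<lambda>_. F u) \<le> integral {u..u + h k} F"
        "integral {u..u + h k} F \<le> integral {u..u + h k} (\<lambda>_. F (u + h k))"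
        by (intro integral_le int_F integrable_const_ivl monoD[OF mono]; simp)+
      then show "h k * F u \<le> integral {u..u + h k} F" "integral {u..u + h k} F \<le> h k * F (u + h k)"
        using h(1)[of k] by simp_all
    qed
    have int_f: "integral {a..b} (f k) = 2 ^ k * (integral {b..b + h k} F - integral {a..a + h k} F)" for k
    proof -
      have "integral {a..b} (f k) = 2 ^ k * (integral {a..b} (\<lambda>x. F (x + h k)) - integral {a..b} F)"
        unfolding f_def using integrable_continuous_interval[OF contI] int_F
        by (simp add: Henstock_Kurzweil_Integration.integral_diff)
      also have "integral {a..b} (\<lambda>x. F (x + h k)) = integral {a + h k..b + h k} F"
        using integral_shift_Icc_real[of a b F "h k"] by (simp add: comp_def add.commute[of "h k"])
      also have "\<dots> = integral {a..b + h k} F - integral {a..a + h k} F"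
        using Henstock_Kurzweil_Integration.integral_combine[of a "a + h k" "b + h k" F] int_F h(1)[of k] that
        by simp
      also have "integral {a..b + h k} F = integral {a..b} F + integral {b..b + h k} F"
        using Henstock_Kurzweil_Integration.integral_combine[of a b "b + h k" F] int_F h(1)[of k] that
        by simp
      finally show ?thesis by simp
    qed
    have F_lim: "(\<lambda>k. F (u + h k)) \<longlonglongrightarrow> F u" for u
    proof -
      have "(\<lambda>k. F (u + h k)) \<longlonglongrightarrow> F (u + 0)"
        by (intro continuous_on_tendsto_compose[OF cont] tendsto_intros h_lim) auto
      then show ?thesis by simp
    qed
    have "(\<lambda>k. integral {a..b} (f k)) \<longlonglongrightarrow> F b - F a"
    proof (rule tendsto_sandwich)
      have "F b - F (a + h k) \<le> integral {a..b} (f k) \<and> integral {a..b} (f k) \<le> F (b + h k) - F a" for k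
      proof -
        have "h k * (F b - F (a + h k)) \<le> integral {b..b + h k} F - integral {a..a + h k} F"
          "integral {b..b + h k} F - integral {a..a + h k} F \<le> h k * (F (b + h k) - F a)"
          using sandwich[where u = a and k = k] sandwich[where u = b and k = k]
          by (simp_all only: right_diff_distrib)
        then have "2 ^ k * (h k * (F b - F (a + h k))) \<le> integral {a..b} (f k)"
          "integral {a..b} (f k) \<le> 2 ^ k * (h k * (F (b + h k) - F a))"
          unfolding int_f by (simp_all only: mult_left_mono zero_le_power zero_le_numeral)
        then show ?thesis using h(2)[of k] by (simp flip: mult.assoc)
      qed
      then show "\<forall>\<^sub>F k in sequentially. F b - F (a + h k) \<le> integral {a..b} (f k)"
        "\<forall>\<^sub>F k in sequentially. integral {a..b} (f k) \<le> F (b + h k) - F a"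
        by auto
      show "(\<lambda>k. F b - F (a + h k)) \<longlonglongrightarrow> F b - F a"
        "(\<lambda>k. F (b + h k) - F a) \<longlonglongrightarrow> F b - F a"
        by (intro tendsto_diff tendsto_const F_lim)+
    qed
    moreover have "g integrable_on {a..b}" "(\<lambda>k. integral {a..b} (f k)) \<longlonglongrightarrow> integral {a..b} g"
      using dominated_convergence[of f "{a..b}" "\<lambda>_. C" g]
        integrable_continuous_interval[OF f_cont] f_bounds g by auto
    ultimately show ?thesis
      using LIMSEQ_unique has_integral_integral by metis
  qed
  have g_nonneg: "0 \<le> g x" for x using g_lc by (simp add: log_concave_def)
  have "(\<integral>\<^sup>+x. ennreal (g x) * indicator {..b} x \<partial>lborel) = ennreal (F b)" for b
  proof (rule LIMSEQ_unique)
    \<comment> \<open>Bounded intervals, where \<open>g_int\<close> applies, exhaust the half-line;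
      the missing mass \<open>F (b - real n)\<close> tends to 0.\<close>
    define G where "G n x = ennreal (indicator {b - real n..b} x * g x)" for n x
    have "(\<lambda>n. integral\<^sup>N lborel (G n)) \<longlonglongrightarrow> (\<integral>\<^sup>+x. ennreal (g x) * indicator {..b} x \<partial>lborel)"
    proof (rule nn_integral_LIMSEQ)
      show "incseq G"
        by (auto simp: incseq_def le_fun_def G_def indicator_def g_nonneg)
      show "G n \<in> borel_measurable lborel" for n
        unfolding G_def using g_meas by measurable
      fix x
      have "\<forall>\<^sub>F n in sequentially. b - x \<le> real n"
        by real_asymp
      then have "\<forall>\<^sub>F n in sequentially. G n x = ennreal (g x) * indicator {..b} x"
        by eventually_elim (auto simp: G_def indicator_def)
      then show "(\<lambda>n. G n x) \<longlonglongrightarrow> ennreal (g x) * indicator {..b} x"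
        by (rule tendsto_eventually)
    qed
    moreover have "integral\<^sup>N lborel (G n) = ennreal (F b - F (b - real n))" for n
      unfolding G_def by (intro nn_integral_has_integral_lebesgue g_int g_nonneg) auto
    ultimately show "(\<lambda>n. ennreal (F b - F (b - real n))) \<longlonglongrightarrow> (\<integral>\<^sup>+x. ennreal (g x) * indicator {..b} x \<partial>lborel)"
      by simp
    have "filterlim (\<lambda>n. b - real n) at_bot sequentially"
      by real_asymp
    then have "(\<lambda>n. F b - F (b - real n)) \<longlonglongrightarrow> F b - 0"
      by (intro tendsto_intros filterlim_compose[OF bot])
    then show "(\<lambda>n. ennreal (F b - F (b - real n))) \<longlonglongrightarrow> ennreal (F b)"
      by simp
  qed
  then show ?thesis using g_meas g_lc by blast
qed

section \<open>The walk as a function of its choices\<close>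

text \<open>\<open>erw_path n c\<close> is the step \<open>X n\<close> computed from the values \<open>c\<close> of the driving choices, so that it
  depends only on those in \<open>erw_history n\<close>.\<close>

fun erw_path :: "nat \<Rightarrow> (erw_choice \<Rightarrow> int) \<Rightarrow> real" where
  "erw_path 0 c = 0"
| "erw_path (Suc 0) c = real_of_int (c First_Step)"
| "erw_path (Suc (Suc n)) c =
     (\<Sum>j = 1..Suc n. erw_path j c * (real_of_int (c (Sign (Suc n))) * of_bool (c (Recall (Suc n)) = int j)))"

text \<open>Writing the recalled step as a sum over all times makes each summand a product of a
  function of the past and a function of the two fresh choices, the form that independence
  needs.\<close>

lemma erw_path_Suc:
  "1 \<le> n \<Longrightarrow> erw_path (Suc n) c =
     (\<Sum>j = 1..n. erw_path j c * (real_of_int (c (Sign n)) * of_bool (c (Recall n) = int j)))"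
  by (cases n) auto

definition erw_history :: "nat \<Rightarrow> erw_choice set" where
  "erw_history n = {First_Step} \<union> Recall ` {1..<n} \<union> Sign ` {1..<n}"

text \<open>The history stops strictly below \<open>n\<close> because \<open>Recall n\<close> and
  \<open>Sign n\<close> produce step \<open>n + 1\<close>.\<close>

lemma erw_path_restrict: "m \<le> n \<Longrightarrow> erw_path m (restrict c (erw_history n)) = erw_path m c"
proof (induction m rule: less_induct)
  case (less m)
  show ?case
  proof (cases "m \<le> 1")
    case True
    then show ?thesis by (cases m) (auto simp: erw_history_def)
  next
    case False
    then obtain k where k: "m = Suc k" "1 \<le> k" by (cases m) auto
    then have "Sign k \<in> erw_history n" "Recall k \<in> erw_history n"
      using less.prems by (auto simp: erw_history_def)
    moreover have "erw_path j (restrict c (erw_history n)) = erw_path j c" if "j \<in> {1..k}" for j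
      by (rule less.IH) (use less.prems that k in auto)
    ultimately show ?thesis
      using k by (simp add: erw_path_Suc del: restrict_apply) (simp add: cong: sum.cong)
  qed
qed

lemma measurable_erw_path:
  "m \<le> n \<Longrightarrow> erw_path m \<in> borel_measurable (PiM (erw_history n) (\<lambda>_. count_space UNIV))"
proof (induction m rule: less_induct)
  case (less m)
  have comp: "(\<lambda>c. f (c i)) \<in> borel_measurable (PiM (erw_history n) (\<lambda>_. count_space UNIV))"
    if "i \<in> erw_history n" for i and f :: "int \<Rightarrow> real"
    by (rule measurable_compose[OF measurable_component_singleton[OF that]]) simp
  show ?case
  proof (cases "m \<le> 1")
    case True
    then consider "m = 0" | "m = Suc 0" by linarith
    then show ?thesis
    proof cases
      case 1
      then show ?thesis by (simp add: erw_path.simps(1)[abs_def])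
    next
      case 2
      have "First_Step \<in> erw_history n" by (simp add: erw_history_def)
      from comp[OF this, of real_of_int] show ?thesis
        by (simp add: 2 erw_path.simps(2)[abs_def])
    qed
  next
    case False
    then obtain k where k: "m = Suc k" "1 \<le> k" by (cases m) auto
    then have "Sign k \<in> erw_history n" "Recall k \<in> erw_history n"
      using less.prems by (auto simp: erw_history_def)
    note comp[OF this(1), of real_of_int] comp[OF this(2)]
    moreover have "erw_path j \<in> borel_measurable (PiM (erw_history n) (\<lambda>_. count_space UNIV))"
      if "j \<in> {1..k}" for j
      using less that k by auto
    ultimately have "(\<lambda>c. \<Sum>j = 1..k. erw_path j c * (real_of_int (c (Sign k)) * of_bool (c (Recall k) = int j)))
      \<in> borel_measurable (PiM (erw_history n) (\<lambda>_. count_space UNIV))"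
      by (intro borel_measurable_sum borel_measurable_times) auto
    then show ?thesis
      using erw_path_Suc[OF k(2)] k(1) by (simp add: fun_eq_iff[symmetric] cong: measurable_cong)
  qed
qed

context elephant_random_walk
begin

definition choice_val :: "erw_choice \<Rightarrow> 'w \<Rightarrow> int" where
  "choice_val = (\<lambda>c. case c of First_Step \<Rightarrow> X 1 | Recall n \<Rightarrow> (\<lambda>\<omega>. int (U n \<omega>)) | Sign n \<Rightarrow> \<epsilon> n)"

text \<open>The locale ties \<open>X\<close> to the choices only almost surely. This version is an
  exact function of them, so independence applies to it directly; \<open>AE_path_step\<close>
  identifies it with \<open>X\<close>.\<close>

definition path_step :: "nat \<Rightarrow> 'w \<Rightarrow> real" where
  "path_step n \<omega> = erw_path n (\<lambda>c. choice_val c \<omega>)"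

definition path_position :: "nat \<Rightarrow> 'w \<Rightarrow> real" where
  "path_position n \<omega> = (\<Sum>i = 1..n. path_step i \<omega>)"

lemma choice_val_simps [simp]:
  "choice_val First_Step \<omega> = X 1 \<omega>" "choice_val (Recall n) \<omega> = int (U n \<omega>)" "choice_val (Sign n) \<omega> = \<epsilon> n \<omega>"
  by (simp_all add: choice_val_def)

lemma indep_choice_val:
  "indep_vars (\<lambda>_. count_space UNIV) choice_val ({First_Step} \<union> Recall ` {1..} \<union> Sign ` {1..})"
  using choices_indep unfolding choice_val_def .

lemma indep_history:
  assumes "1 \<le> n"
    and "f \<in> borel_measurable (PiM (erw_history n) (\<lambda>_. count_space UNIV))"
    and "g \<in> borel_measurable (PiM {Recall n, Sign n} (\<lambda>_. count_space UNIV))"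
  shows "indep_var borel (\<lambda>\<omega>. f (restrict (\<lambda>c. choice_val c \<omega>) (erw_history n)) :: real)
    borel (\<lambda>\<omega>. g (restrict (\<lambda>c. choice_val c \<omega>) {Recall n, Sign n}) :: real)"
proof -
  have "indep_var (PiM (erw_history n) (\<lambda>_. count_space UNIV)) (\<lambda>\<omega>. restrict (\<lambda>c. choice_val c \<omega>) (erw_history n))
    (PiM {Recall n, Sign n} (\<lambda>_. count_space UNIV)) (\<lambda>\<omega>. restrict (\<lambda>c. choice_val c \<omega>) {Recall n, Sign n})"
    using assms(1) by (intro indep_var_restrict[OF indep_choice_val]) (auto simp: erw_history_def)
  from indep_var_compose[OF this assms(2,3)] show ?thesis
    by (simp add: comp_def)
qed

lemma AE_sign: assumes "1 \<le> n" shows "AE \<omega> in M. \<epsilon> n \<omega> = 1 \<or> \<epsilon> n \<omega> = -1"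
proof -
  note [measurable] = measurable_sign[OF assms]
  have "prob {\<omega> \<in> space M. \<epsilon> n \<omega> = 1 \<or> \<epsilon> n \<omega> = -1} =
      prob ({\<omega> \<in> space M. \<epsilon> n \<omega> = 1} \<union> {\<omega> \<in> space M. \<epsilon> n \<omega> = -1})"
    by (intro arg_cong[where f = prob]) auto
  also have "\<dots> = 1"
    using sign_law[OF assms] by (subst finite_measure_Union) auto
  finally show ?thesis
    by (subst (asm) prob_Collect_eq_1) auto
qed

lemma AE_first: "AE \<omega> in M. X 1 \<omega> = 1 \<or> X 1 \<omega> = -1"
proof -
  note [measurable] = measurable_X[of 1, simplified]
  have "prob {\<omega> \<in> space M. X 1 \<omega> = 1 \<or> X 1 \<omega> = -1} =
      prob ({\<omega> \<in> space M. X 1 \<omega> = 1} \<union> {\<omega> \<in> space M. X 1 \<omega> = -1})"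
    by (intro arg_cong[where f = prob]) auto
  also have "\<dots> = 1"
    using first_step by (subst finite_measure_Union) auto
  finally show ?thesis
    by (subst (asm) prob_Collect_eq_1) auto
qed

lemma AE_recall: assumes "1 \<le> n" shows "AE \<omega> in M. U n \<omega> \<in> {1..n}"
proof -
  note [measurable] = measurable_U[OF assms]
  have "prob {\<omega> \<in> space M. U n \<omega> \<in> {1..n}} = prob (\<Union>k\<in>{1..n}. {\<omega> \<in> space M. U n \<omega> = k})"
    by (intro arg_cong[where f = prob]) auto
  also have "\<dots> = (\<Sum>k\<in>{1..n}. prob {\<omega> \<in> space M. U n \<omega> = k})"
    by (intro finite_measure_finite_Union) (auto simp: disjoint_family_on_def)
  also have "\<dots> = 1"
    using recall_uniform[OF assms] assms by simp
  finally show ?thesis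
    by (subst (asm) prob_Collect_eq_1) auto
qed

lemma AE_path_step: "AE \<omega> in M. \<forall>n\<ge>1. path_step n \<omega> = real_of_int (X n \<omega>) \<and> \<bar>X n \<omega>\<bar> = 1"
proof -
  have "AE \<omega> in M. \<forall>n\<in>{1..}. X (Suc n) \<omega> = \<epsilon> n \<omega> * X (U n \<omega>) \<omega>"
    using step by (subst AE_ball_countable) auto
  moreover have "AE \<omega> in M. \<forall>n\<in>{1..}. U n \<omega> \<in> {1..n}"
    using AE_recall by (subst AE_ball_countable) auto
  moreover have "AE \<omega> in M. \<forall>n\<in>{1..}. \<epsilon> n \<omega> = 1 \<or> \<epsilon> n \<omega> = -1"
    using AE_sign by (subst AE_ball_countable) auto
  ultimately show ?thesis
    using AE_first
  proof eventually_elim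
    case (elim \<omega>)
    show ?case
    proof (intro allI impI)
      fix n :: nat assume "1 \<le> n"
      then show "path_step n \<omega> = real_of_int (X n \<omega>) \<and> \<bar>X n \<omega>\<bar> = 1"
      proof (induction n rule: less_induct)
        case (less n)
        show ?case
        proof (cases "n = 1")
          case True
          then show ?thesis using elim by (auto simp: path_step_def)
        next
          case False
          then obtain k where k: "n = Suc k" "1 \<le> k" using less.prems by (cases n) auto
          have U: "U k \<omega> \<in> {1..k}" using elim k by auto
          have "path_step n \<omega> = (\<Sum>j = 1..k. path_step j \<omega> * (real_of_int (\<epsilon> k \<omega>) * of_bool (U k \<omega> = j)))"
            using k by (simp add: path_step_def erw_path_Suc)
          also have "\<dots> = (\<Sum>j\<in>{U k \<omega>}. path_step j \<omega> * real_of_int (\<epsilon> k \<omega>))"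
            using U by (intro sum.mono_neutral_cong_right) auto
          also have "\<dots> = real_of_int (\<epsilon> k \<omega> * X (U k \<omega>) \<omega>)"
            using less.IH[of "U k \<omega>"] U k by auto
          finally have "path_step n \<omega> = real_of_int (\<epsilon> k \<omega> * X (U k \<omega>) \<omega>)" .
          moreover have "\<epsilon> k \<omega> = 1 \<or> \<epsilon> k \<omega> = - 1" "X n \<omega> = \<epsilon> k \<omega> * X (U k \<omega>) \<omega>"
            using elim(1,3) k by auto
          ultimately show ?thesis
            using less.IH[of "U k \<omega>"] U k by (auto simp: abs_mult)
        qed
      qed
    qed
  qed
qed

lemma AE_path_step_cases:
  assumes "1 \<le> n"
  shows "AE \<omega> in M. path_step n \<omega> = 1 \<or> path_step n \<omega> = -1"
  using AE_path_step
proof eventually_elim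
  case (elim \<omega>)
  then have "path_step n \<omega> = real_of_int (X n \<omega>)" "X n \<omega> = 1 \<or> X n \<omega> = -1"
    using assms by (auto simp: abs_if split: if_splits)
  then show ?case by auto
qed

lemma path_position_eq: "AE \<omega> in M. \<forall>n. path_position n \<omega> = real_of_int (erw_position X n \<omega>)"
  using AE_path_step by eventually_elim (auto simp: path_position_def erw_position_def intro!: sum.cong)

lemma path_step_restrict:
  "m \<le> n \<Longrightarrow> path_step m \<omega> = erw_path m (restrict (\<lambda>c. choice_val c \<omega>) (erw_history n))"
  by (simp only: path_step_def erw_path_restrict)

lemma measurable_history:
  assumes "1 \<le> n"
  shows "(\<lambda>\<omega>. restrict (\<lambda>c. choice_val c \<omega>) (erw_history n)) \<in> measurable M (PiM (erw_history n) (\<lambda>_. count_space UNIV))"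
proof -
  have "choice_val c \<in> measurable M (count_space UNIV)" if "c \<in> erw_history n" for c
    using indep_choice_val that unfolding indep_vars_def erw_history_def by auto
  then show ?thesis
    by (intro measurable_restrict) auto
qed

lemma path_step_measurable [measurable]: "path_step m \<in> borel_measurable M"
proof -
  have "(\<lambda>\<omega>. erw_path m (restrict (\<lambda>c. choice_val c \<omega>) (erw_history (max 1 m)))) \<in> borel_measurable M"
    by (rule measurable_compose[OF measurable_history measurable_erw_path]) auto
  then show ?thesis
    using path_step_restrict[of m "max 1 m"] by (simp add: fun_eq_iff[symmetric] cong: measurable_cong)
qed

lemma path_position_measurable [measurable]: "path_position m \<in> borel_measurable M"
  unfolding path_position_def[abs_def] by measurable

section \<open>Transition probabilities of the walk\<close>

lemma expectation_sign_recall: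
  assumes "j \<in> {1..n}"
  shows "expectation (\<lambda>\<omega>. real_of_int (\<epsilon> n \<omega>) * of_bool (U n \<omega> = j)) = (2 * p - 1) / real n"
proof -
  have n: "1 \<le> n" using assms by simp
  note [measurable] = measurable_sign[OF n] measurable_U[OF n]
  have prod: "prob {\<omega> \<in> space M. \<epsilon> n \<omega> = e \<and> U n \<omega> = j} = prob {\<omega> \<in> space M. \<epsilon> n \<omega> = e} / real n" for e
  proof -
    define A where "A c = (case c of Sign _ \<Rightarrow> {e} | _ \<Rightarrow> {int j})" for c
    have "prob (\<Inter>c\<in>{Recall n, Sign n}. choice_val c -` A c \<inter> space M)
        = (\<Prod>c\<in>{Recall n, Sign n}. prob (choice_val c -` A c \<inter> space M))"
      using n by (intro indep_varsD[OF indep_choice_val]) auto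
    moreover have "(\<Inter>c\<in>{Recall n, Sign n}. choice_val c -` A c \<inter> space M) = {\<omega> \<in> space M. \<epsilon> n \<omega> = e \<and> U n \<omega> = j}"
      "choice_val (Recall n) -` A (Recall n) \<inter> space M = {\<omega> \<in> space M. U n \<omega> = j}"
      "choice_val (Sign n) -` A (Sign n) \<inter> space M = {\<omega> \<in> space M. \<epsilon> n \<omega> = e}"
      by (auto simp: A_def)
    ultimately show ?thesis
      using recall_uniform[OF n assms] by simp
  qed
  define E where "E e = {\<omega> \<in> space M. \<epsilon> n \<omega> = e \<and> U n \<omega> = j}" for e
  have [measurable]: "E e \<in> sets M" for e
    unfolding E_def by measurable
  have "expectation (\<lambda>\<omega>. real_of_int (\<epsilon> n \<omega>) * of_bool (U n \<omega> = j)) =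
     expectation (\<lambda>\<omega>. indicator (E 1) \<omega> - indicator (E (- 1)) \<omega>)"
    using AE_sign[OF n] AE_space
    by (intro integral_cong_AE) (auto simp: E_def indicator_def elim!: eventually_elim2)
  also have "\<dots> = prob (E 1) - prob (E (- 1))"
    by (subst Bochner_Integration.integral_diff) (auto simp: emeasure_eq_measure)
  also have "\<dots> = (2 * p - 1) / real n"
    unfolding E_def prod sign_law(1)[OF n] sign_law(2)[OF n] by (simp flip: diff_divide_distrib)
  finally show ?thesis .
qed

text \<open>Every past step is recalled with the same probability, so each contributes with the same
  factor \<open>c\<close> and the past enters only through its sum, here equal to \<open>s\<close>.
  This is why the position is a Markov chain.\<close>

lemma expectation_path_step_Suc:
  assumes n: "1 \<le> n"
  shows "expectation (\<lambda>\<omega>. path_step (Suc n) \<omega> * of_bool (path_position n \<omega> = s)) =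
    (2 * p - 1) * s / real n * prob {\<omega> \<in> space M. path_position n \<omega> = s}"
proof -
  note [measurable] = measurable_sign[OF n] measurable_U[OF n]
  define c where "c = (2 * p - 1) / real n"
  define I where "I \<omega> = (of_bool (path_position n \<omega> = s) :: real)" for \<omega>
  define V where "V j \<omega> = real_of_int (\<epsilon> n \<omega>) * of_bool (U n \<omega> = j)" for j :: nat and \<omega>
  have [measurable]: "I \<in> borel_measurable M" "V j \<in> borel_measurable M" for j
    unfolding I_def V_def of_bool_def by measurable
  have step_bound: "AE \<omega> in M. \<bar>path_step j \<omega>\<bar> \<le> 1" if "1 \<le> j" for j
    using AE_path_step by eventually_elim (use that in \<open>auto simp flip: of_int_abs\<close>)
  have int_step: "integrable M (\<lambda>\<omega>. path_step j \<omega> * I \<omega>)" if "1 \<le> j" for j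
    by (rule integrable_const_bound[where B = 1], use step_bound[OF that] in eventually_elim) (auto simp: I_def)
  have int_V: "integrable M (V j)" for j
    by (rule integrable_const_bound[where B = 1], use AE_sign[OF n] in eventually_elim) (auto simp: V_def)
  have prod: "integrable M (\<lambda>\<omega>. (path_step j \<omega> * I \<omega>) * V j \<omega>)"
    "expectation (\<lambda>\<omega>. (path_step j \<omega> * I \<omega>) * V j \<omega>) = expectation (\<lambda>\<omega>. path_step j \<omega> * I \<omega>) * c"
    if j: "j \<in> {1..n}" for j
  proof -
    define f where "f c = erw_path j c * (of_bool ((\<Sum>i = 1..n. erw_path i c) = s) :: real)" for c
    define g where "g c = real_of_int (c (Sign n)) * (of_bool (c (Recall n) = int j) :: real)" for c
    have [measurable]: "erw_path i \<in> borel_measurable (PiM (erw_history n) (\<lambda>_. count_space UNIV))" if "i \<in> {1..n}" for i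
      using that by (intro measurable_erw_path) auto
    have "f \<in> borel_measurable (PiM (erw_history n) (\<lambda>_. count_space UNIV))"
      unfolding f_def of_bool_def using j by measurable
    moreover have "g \<in> borel_measurable (PiM {Recall n, Sign n} (\<lambda>_. count_space UNIV))"
    proof -
      have "(\<lambda>c. h (c i)) \<in> borel_measurable (PiM {Recall n, Sign n} (\<lambda>_. count_space UNIV))"
        if "i \<in> {Recall n, Sign n}" for i and h :: "int \<Rightarrow> real"
        by (rule measurable_compose[OF measurable_component_singleton[OF that]]) simp
      then show ?thesis
        unfolding g_def by (intro borel_measurable_times) auto
    qed
    ultimately have "indep_var borel (\<lambda>\<omega>. f (restrict (\<lambda>c. choice_val c \<omega>) (erw_history n)))
      borel (\<lambda>\<omega>. g (restrict (\<lambda>c. choice_val c \<omega>) {Recall n, Sign n}))"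
      by (intro indep_history n)
    also have "(\<lambda>\<omega>. f (restrict (\<lambda>c. choice_val c \<omega>) (erw_history n))) = (\<lambda>\<omega>. path_step j \<omega> * I \<omega>)"
      unfolding f_def I_def path_position_def using j
      by (simp add: path_step_restrict[of _ n] del: restrict_apply)
    also have "(\<lambda>\<omega>. g (restrict (\<lambda>c. choice_val c \<omega>) {Recall n, Sign n})) = V j"
      by (simp add: g_def V_def fun_eq_iff)
    finally have ind: "indep_var borel (\<lambda>\<omega>. path_step j \<omega> * I \<omega>) borel (V j)" .
    show "integrable M (\<lambda>\<omega>. (path_step j \<omega> * I \<omega>) * V j \<omega>)"
      using indep_var_integrable[OF ind int_step int_V] j by simp
    show "expectation (\<lambda>\<omega>. (path_step j \<omega> * I \<omega>) * V j \<omega>) = expectation (\<lambda>\<omega>. path_step j \<omega> * I \<omega>) * c"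
      using indep_var_lebesgue_integral[OF ind int_step int_V] j expectation_sign_recall[OF j]
      by (simp add: V_def c_def)
  qed
  have "expectation (\<lambda>\<omega>. path_step (Suc n) \<omega> * I \<omega>) = expectation (\<lambda>\<omega>. \<Sum>j = 1..n. (path_step j \<omega> * I \<omega>) * V j \<omega>)"
    using n by (intro Bochner_Integration.integral_cong)
      (auto simp: path_step_def erw_path_Suc V_def sum_distrib_right intro!: sum.cong)
  also have "\<dots> = (\<Sum>j = 1..n. expectation (\<lambda>\<omega>. path_step j \<omega> * I \<omega>)) * c"
    using prod by (subst Bochner_Integration.integral_sum) (simp_all add: sum_distrib_right)
  also have "(\<Sum>j = 1..n. expectation (\<lambda>\<omega>. path_step j \<omega> * I \<omega>)) = expectation (\<lambda>\<omega>. \<Sum>j = 1..n. path_step j \<omega> * I \<omega>)"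
    using int_step by (subst Bochner_Integration.integral_sum) auto
  also have "\<dots> = expectation (\<lambda>\<omega>. s * indicator {\<omega> \<in> space M. path_position n \<omega> = s} \<omega>)"
    by (intro Bochner_Integration.integral_cong)
      (auto simp: I_def path_position_def indicator_def simp flip: sum_distrib_right)
  also have "\<dots> = s * prob {\<omega> \<in> space M. path_position n \<omega> = s}"
    by (simp add: Int_absorb1 Collect_mono_iff)
  finally show ?thesis
    by (simp add: I_def c_def)
qed

text \<open>For a step with values 1 and -1, the indicator of the value \<open>e\<close> is
  \<open>(1 + e * path_step (Suc n) \<omega>) / 2\<close>, so its mean determines its law.\<close>

lemma prob_path_step_Suc:
  assumes n: "1 \<le> n" and e: "e = 1 \<or> e = -1"
  shows "prob {\<omega> \<in> space M. path_position n \<omega> = s \<and> path_step (Suc n) \<omega> = e} =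
    (1 + e * (2 * p - 1) * s / real n) / 2 * prob {\<omega> \<in> space M. path_position n \<omega> = s}"
proof -
  have step: "AE \<omega> in M. path_step (Suc n) \<omega> = 1 \<or> path_step (Suc n) \<omega> = -1"
    by (rule AE_path_step_cases) simp
  have int: "integrable M (\<lambda>\<omega>. path_step (Suc n) \<omega> * of_bool (path_position n \<omega> = s))"
    "integrable M (\<lambda>\<omega>. of_bool (path_position n \<omega> = s) :: real)"
    by (rule integrable_const_bound[where B = 1], use step in eventually_elim; auto simp: of_bool_def)+
  have "prob {\<omega> \<in> space M. path_position n \<omega> = s \<and> path_step (Suc n) \<omega> = e} =
      expectation (indicator {\<omega> \<in> space M. path_position n \<omega> = s \<and> path_step (Suc n) \<omega> = e})"
    by simp
  also have "\<dots> = expectation (\<lambda>\<omega>. (of_bool (path_position n \<omega> = s) + e * (path_step (Suc n) \<omega> * of_bool (path_position n \<omega> = s))) / 2)"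
    using step AE_space e
    by (intro integral_cong_AE) (auto simp: indicator_def of_bool_def elim!: eventually_elim2)
  also have "\<dots> = (expectation (\<lambda>\<omega>. of_bool (path_position n \<omega> = s)) +
      e * expectation (\<lambda>\<omega>. path_step (Suc n) \<omega> * of_bool (path_position n \<omega> = s))) / 2"
    using int by simp
  also have "expectation (\<lambda>\<omega>. of_bool (path_position n \<omega> = s)) = expectation (indicator {\<omega> \<in> space M. path_position n \<omega> = s})"
    by (intro Bochner_Integration.integral_cong) (auto simp: indicator_def)
  also have "\<dots> = prob {\<omega> \<in> space M. path_position n \<omega> = s}"
    by simp
  finally show ?thesis
    unfolding expectation_path_step_Suc[OF n] by (simp add: field_simps)
qed

text \<open>With \<open>k\<close> up-steps among \<open>N = n + 1\<close> steps the position is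
  \<open>2 * k - N\<close>, and
  \<open>(1 + a * (2 * k - N) / N) / 2 = (1 - a) / 2 + a * k / N\<close> is
  \<open>erw_weight\<close>.\<close>

lemma prob_path_position:
  assumes "q = 1"
  shows "prob {\<omega> \<in> space M. path_position (Suc n) \<omega> = real_of_int (2 * k - int (Suc n))} = erw_law (2 * p - 1) n k"
proof (induction n arbitrary: k)
  case 0
  have X1: "AE \<omega> in M. X 1 \<omega> = 1"
  proof -
    note [measurable] = measurable_X[of 1, simplified]
    have "prob {\<omega> \<in> space M. X 1 \<omega> = 1} = 1"
      using first_step(1) assms by simp
    then show ?thesis
      by (subst (asm) prob_Collect_eq_1) auto
  qed
  have "prob {\<omega> \<in> space M. path_position (Suc 0) \<omega> = real_of_int (2 * k - 1)} = prob {\<omega> \<in> space M. k = 1}"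
  proof (rule finite_measure_eq_AE)
    show "AE \<omega> in M. \<omega> \<in> {\<omega> \<in> space M. path_position (Suc 0) \<omega> = real_of_int (2 * k - 1)} \<longleftrightarrow> \<omega> \<in> {\<omega> \<in> space M. k = 1}"
      using X1 AE_space
    proof eventually_elim
      case (elim \<omega>)
      then have "path_position (Suc 0) \<omega> = real_of_int 1"
        by (simp add: path_position_def path_step_def)
      then show ?case using elim by (simp only: of_int_eq_iff mem_Collect_eq) auto
    qed
  qed auto
  then show ?case by (simp add: prob_space)
next
  case (Suc n)
  define N where "N = Suc n"
  have step: "AE \<omega> in M. path_step (Suc N) \<omega> = 1 \<or> path_step (Suc N) \<omega> = -1"
    by (rule AE_path_step_cases) simp
  have pos: "path_position (Suc N) \<omega> = path_position N \<omega> + path_step (Suc N) \<omega>" for \<omega>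
    by (simp add: path_position_def)
  define E where "E m e = {\<omega> \<in> space M. path_position N \<omega> = real_of_int (2 * m - int N) \<and> path_step (Suc N) \<omega> = e}" for m e
  have [measurable]: "E m e \<in> sets M" for m e
    unfolding E_def by measurable
  have E: "prob (E m e) = (1 + e * (2 * p - 1) * real_of_int (2 * m - int N) / real N) / 2 * erw_law (2 * p - 1) n m"
    if "e = 1 \<or> e = -1" for m e
    using prob_path_step_Suc[of N e "real_of_int (2 * m - int N)"] that Suc.IH[of m] by (simp add: E_def N_def)
  have "prob {\<omega> \<in> space M. path_position (Suc N) \<omega> = real_of_int (2 * k - int (Suc N))} = prob (E k (- 1) \<union> E (k - 1) 1)"
    using step by (intro finite_measure_eq_AE) (auto simp: E_def pos)
  also have "\<dots> = prob (E k (- 1)) + prob (E (k - 1) 1)"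
    by (intro finite_measure_Union) (auto simp: E_def)
  also have "\<dots> = erw_law (2 * p - 1) (Suc n) k"
  proof -
    have "(1 + (- 1) * (2 * p - 1) * real_of_int (2 * k - int N) / real N) / 2 = 1 - erw_weight (2 * p - 1) n k"
      "(1 + 1 * (2 * p - 1) * real_of_int (2 * (k - 1) - int N) / real N) / 2 = erw_weight (2 * p - 1) n (k - 1)"
      by (simp_all add: erw_weight_def N_def field_simps)
    then show ?thesis
      unfolding erw_law.simps(2) by (subst (1 2) E) auto
  qed
  finally show ?case by (simp add: N_def)
qed

end

section \<open>Passage to the limit\<close>

context prob_space
begin

text \<open>Where \<open>L\<close> equals \<open>x\<close>, the variables \<open>Y n\<close>
  eventually enter every window around \<open>x\<close>, so an atom would have mass at most
  \<open>C * e\<close> for all \<open>e > 0\<close>.\<close>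

lemma no_atom_of_limit:
  fixes L :: "'a \<Rightarrow> real"
  assumes [measurable]: "\<And>n. Y n \<in> borel_measurable M" "L \<in> borel_measurable M"
    and lim: "AE \<omega> in M. (\<lambda>n. Y n \<omega>) \<longlonglongrightarrow> L \<omega>"
    and small: "\<And>e. 0 < e \<Longrightarrow> \<forall>\<^sub>F n in sequentially. prob {\<omega> \<in> space M. x - e < Y n \<omega> \<and> Y n \<omega> \<le> x + e} \<le> C * e"
  shows "prob {\<omega> \<in> space M. L \<omega> = x} = 0"
proof -
  have bound: "prob {\<omega> \<in> space M. L \<omega> = x} \<le> C * e" if e: "0 < e" for e
  proof (rule LIMSEQ_le_const2)
    define A where "A n = {\<omega> \<in> space M. L \<omega> = x \<and> x - e < Y n \<omega> \<and> Y n \<omega> \<le> x + e}" for n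
    have [measurable]: "A n \<in> sets M" for n unfolding A_def by measurable
    have "(\<lambda>n. expectation (indicat_real (A n))) \<longlonglongrightarrow> expectation (indicat_real {\<omega> \<in> space M. L \<omega> = x})"
    proof (rule integral_dominated_convergence[where w = "\<lambda>_. 1"])
      show "AE \<omega> in M. (\<lambda>n. indicat_real (A n) \<omega>) \<longlonglongrightarrow> indicat_real {\<omega> \<in> space M. L \<omega> = x} \<omega>"
        using lim
      proof eventually_elim
        case (elim \<omega>)
        show ?case
        proof (cases "L \<omega> = x")
          case True
          have "\<forall>\<^sub>F n in sequentially. x - e < Y n \<omega>" "\<forall>\<^sub>F n in sequentially. Y n \<omega> < x + e"
            using True e by (auto intro: order_tendstoD[OF elim])
          then have "\<forall>\<^sub>F n in sequentially. indicat_real (A n) \<omega> = indicat_real {\<omega> \<in> space M. L \<omega> = x} \<omega>"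
            by eventually_elim (auto simp: A_def indicator_def)
          then show ?thesis by (rule tendsto_eventually)
        qed (auto simp: A_def)
      qed
    qed auto
    then show "(\<lambda>n. prob (A n)) \<longlonglongrightarrow> prob {\<omega> \<in> space M. L \<omega> = x}"
      by simp
    obtain N where N: "\<And>n. n \<ge> N \<Longrightarrow> prob {\<omega> \<in> space M. x - e < Y n \<omega> \<and> Y n \<omega> \<le> x + e} \<le> C * e"
      using small[OF e] by (auto simp: eventually_sequentially)
    have "prob (A n) \<le> prob {\<omega> \<in> space M. x - e < Y n \<omega> \<and> Y n \<omega> \<le> x + e}" for n
      by (intro finite_measure_mono) (auto simp: A_def)
    then show "\<exists>N. \<forall>n\<ge>N. prob (A n) \<le> C * e"
      using N order_trans by blast
  qed
  have "((\<lambda>e. C * e) \<longlongrightarrow> C * 0) (at_right 0)"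
    by (intro tendsto_intros)
  then have "prob {\<omega> \<in> space M. L \<omega> = x} \<le> C * 0"
    by (rule tendsto_lowerbound) (use bound in \<open>auto simp: eventually_at_filter\<close>)
  then show ?thesis by (simp add: measure_le_0_iff)
qed

text \<open>Off the null event \<open>L = x\<close>, the limit of \<open>Y n - xs n\<close> is
  nonzero and its sign decides the indicator. The thresholds move because they will be rounded to
  the lattice of the walk.\<close>

lemma prob_le_tendsto:
  fixes L :: "'a \<Rightarrow> real"
  assumes [measurable]: "\<And>n. Y n \<in> borel_measurable M" "L \<in> borel_measurable M"
    and lim: "AE \<omega> in M. (\<lambda>n. Y n \<omega>) \<longlonglongrightarrow> L \<omega>"
    and atom: "prob {\<omega> \<in> space M. L \<omega> = x} = 0"
    and x: "xs \<longlonglongrightarrow> x"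
  shows "(\<lambda>n. prob {\<omega> \<in> space M. Y n \<omega> \<le> xs n}) \<longlonglongrightarrow> prob {\<omega> \<in> space M. L \<omega> \<le> x}"
proof -
  have "AE \<omega> in M. L \<omega> \<noteq> x"
    using atom by (subst (asm) prob_Collect_eq_0) auto
  have "(\<lambda>n. expectation (indicat_real {\<omega> \<in> space M. Y n \<omega> \<le> xs n})) \<longlonglongrightarrow> expectation (indicat_real {\<omega> \<in> space M. L \<omega> \<le> x})"
  proof (rule integral_dominated_convergence[where w = "\<lambda>_. 1"])
    show "AE \<omega> in M. (\<lambda>n. indicat_real {\<omega> \<in> space M. Y n \<omega> \<le> xs n} \<omega>) \<longlonglongrightarrow> indicat_real {\<omega> \<in> space M. L \<omega> \<le> x} \<omega>"
      using lim \<open>AE \<omega> in M. L \<omega> \<noteq> x\<close>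
    proof eventually_elim
      case (elim \<omega>)
      have d: "(\<lambda>n. Y n \<omega> - xs n) \<longlonglongrightarrow> L \<omega> - x"
        by (intro tendsto_intros elim x)
      have "\<forall>\<^sub>F n in sequentially. (Y n \<omega> \<le> xs n) = (L \<omega> \<le> x)"
      proof (cases "L \<omega> < x")
        case True
        then have "\<forall>\<^sub>F n in sequentially. Y n \<omega> - xs n < 0"
          by (intro order_tendstoD[OF d]) auto
        then show ?thesis by eventually_elim (use True in auto)
      next
        case False
        then have "\<forall>\<^sub>F n in sequentially. 0 < Y n \<omega> - xs n"
          using elim by (intro order_tendstoD[OF d]) auto
        then show ?thesis by eventually_elim (use False elim in auto)
      qed
      then have "\<forall>\<^sub>F n in sequentially. indicat_real {\<omega> \<in> space M. Y n \<omega> \<le> xs n} \<omega> = indicat_real {\<omega> \<in> space M. L \<omega> \<le> x} \<omega>"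
        by eventually_elim (auto simp: indicator_def)
      then show ?case by (rule tendsto_eventually)
    qed
  qed auto
  then show ?thesis by simp
qed

end

text \<open>The rounding error is below 1 and vanishes after division by \<open>r\<close>. The
  offset \<open>d\<close> is subtracted again exactly, since in the application it is half the time,
  which outgrows \<open>r\<close>.\<close>

lemma floor_affine_tendsto:
  fixes r d :: "nat \<Rightarrow> real"
  assumes r: "filterlim r at_top sequentially"
  shows "(\<lambda>n. (real_of_int \<lfloor>c * r n + d n\<rfloor> - d n) / r n) \<longlonglongrightarrow> c"
proof (rule tendsto_sandwich)
  have pos: "\<forall>\<^sub>F n in sequentially. 0 < r n"
    using r by (simp add: filterlim_at_top_dense)
  show "\<forall>\<^sub>F n in sequentially. c - 1 / r n \<le> (real_of_int \<lfloor>c * r n + d n\<rfloor> - d n) / r n"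
    using pos
  proof eventually_elim
    case (elim n)
    have "c * r n - 1 \<le> real_of_int \<lfloor>c * r n + d n\<rfloor> - d n" by linarith
    then have "(c * r n - 1) / r n \<le> (real_of_int \<lfloor>c * r n + d n\<rfloor> - d n) / r n"
      using elim by (intro divide_right_mono) auto
    then show ?case using elim by (simp add: diff_divide_distrib)
  qed
  show "\<forall>\<^sub>F n in sequentially. (real_of_int \<lfloor>c * r n + d n\<rfloor> - d n) / r n \<le> c"
    using pos
  proof eventually_elim
    case (elim n)
    have "real_of_int \<lfloor>c * r n + d n\<rfloor> - d n \<le> c * r n" by linarith
    then show ?case using elim by (simp add: divide_le_eq)
  qed
  have "(\<lambda>n. 1 / r n) \<longlonglongrightarrow> 0"
    using tendsto_inverse_0_at_top[OF r] by (simp add: inverse_eq_divide)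
  then have "(\<lambda>n. c - 1 / r n) \<longlonglongrightarrow> c - 0"
    by (intro tendsto_intros)
  then show "(\<lambda>n. c - 1 / r n) \<longlonglongrightarrow> c" by simp
qed auto

section \<open>From lattice windows to the density of the limit\<close>

context elephant_random_walk
begin

lemma path_position_parity:
  "AE \<omega> in M. \<forall>n. \<exists>k::int. path_position n \<omega> = real_of_int (2 * k - int n)"
  using AE_path_step
proof eventually_elim
  case (elim \<omega>)
  show ?case
  proof
    fix n
    have "2 dvd (\<Sum>i = 1..n. X i \<omega> + 1)"
      using elim by (intro dvd_sum) (auto simp: abs_if split: if_splits)
    then obtain k where "(\<Sum>i = 1..n. X i \<omega> + 1) = 2 * k" by (rule dvdE)
    then have "(\<Sum>i = 1..n. X i \<omega>) = 2 * k - int n"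
      by (simp add: sum.distrib)
    moreover have "path_position n \<omega> = real_of_int (\<Sum>i = 1..n. X i \<omega>)"
      unfolding path_position_def of_int_sum by (intro sum.cong refl) (use elim in auto)
    ultimately show "\<exists>k::int. path_position n \<omega> = real_of_int (2 * k - int n)"
      by metis
  qed
qed

lemma prob_path_position_interval:
  assumes "q = 1"
  shows "prob {\<omega> \<in> space M. real_of_int (2 * u - int (Suc n)) < path_position (Suc n) \<omega> \<and>
      path_position (Suc n) \<omega> \<le> real_of_int (2 * v - int (Suc n))} = sum (erw_law (2 * p - 1) n) {u<..v}"
    (is "prob ?E = _")
proof -
  define A where "A k = {\<omega> \<in> space M. path_position (Suc n) \<omega> = real_of_int (2 * k - int (Suc n))}" for k
  have [measurable]: "A k \<in> sets M" for k unfolding A_def by measurable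
  have "prob ?E = prob (\<Union>k\<in>{u<..v}. A k)"
  proof (rule finite_measure_eq_AE)
    show "AE \<omega> in M. \<omega> \<in> ?E \<longleftrightarrow> \<omega> \<in> (\<Union>k\<in>{u<..v}. A k)"
      using path_position_parity AE_space
    proof eventually_elim
      case (elim \<omega>)
      from spec[OF elim(1), of "Suc n"]
      obtain k where k: "path_position (Suc n) \<omega> = real_of_int (2 * k - int (Suc n))" ..
      have "\<omega> \<in> A j \<longleftrightarrow> j = k" for j
        unfolding A_def mem_Collect_eq k of_int_eq_iff using elim(2) by auto
      moreover have "\<omega> \<in> ?E \<longleftrightarrow> k \<in> {u<..v}"
        unfolding mem_Collect_eq k of_int_less_iff of_int_le_iff using elim(2) by auto
      ultimately show ?case by auto
    qed
  qed auto
  also have "\<dots> = (\<Sum>k\<in>{u<..v}. prob (A k))"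
    by (intro finite_measure_finite_Union) (auto simp: disjoint_family_on_def A_def)
  also have "\<dots> = sum (erw_law (2 * p - 1) n) {u<..v}"
    unfolding A_def prob_path_position[OF assms] ..
  finally show ?thesis .
qed

lemma log_concave_density_of_limit:
  assumes q: "q = 1" and a: "a = 2 * p - 1" "1 / 2 \<le> a" "a\<^sup>2 + a \<le> 1"
    and limit: "is_erw_limit M a X L"
  shows "\<exists>f :: real \<Rightarrow> real. distributed M lborel L (\<lambda>x. ennreal (f x)) \<and> log_concave f"
proof -
  have [measurable]: "L \<in> borel_measurable M"
    using limit by (simp add: is_erw_limit_def)
  have a23: "a \<le> 2 / 3"
  proof (rule ccontr)
    assume gt: "\<not> ?thesis"
    then have "(2 / 3)\<^sup>2 \<le> a\<^sup>2" by (intro power_mono) auto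
    then show False using a gt by (simp add: power2_eq_square)
  qed
  define r where "r n = real (Suc n) powr a" for n
  have r_pos: "0 < r n" for n by (simp add: r_def)
  have r_lim: "filterlim r at_top sequentially"
    unfolding r_def using a by real_asymp
  define Y where "Y n \<omega> = path_position (Suc n) \<omega> / r n" for n \<omega>
  have [measurable]: "Y n \<in> borel_measurable M" for n unfolding Y_def by measurable
  have Y_lim: "AE \<omega> in M. (\<lambda>n. Y n \<omega>) \<longlonglongrightarrow> L \<omega>"
  proof -
    have "AE \<omega> in M. (\<lambda>n. real n powr (- a) * real_of_int (erw_position X n \<omega>)) \<longlonglongrightarrow> L \<omega>"
      using limit by (simp add: is_erw_limit_def)
    with path_position_eq show ?thesis
    proof eventually_elim
      case (elim \<omega>)
      have "Y n \<omega> = real (Suc n) powr (- a) * real_of_int (erw_position X (Suc n) \<omega>)" for n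
        using elim by (simp add: Y_def r_def powr_minus field_simps)
      then show ?case using LIMSEQ_Suc[OF elim(2)] by simp
    qed
  qed
  define law where "law = erw_law a"
  have interval: "prob {\<omega> \<in> space M. real_of_int (2 * u - int (Suc n)) / r n < Y n \<omega> \<and>
      Y n \<omega> \<le> real_of_int (2 * v - int (Suc n)) / r n} = sum (law n) {u<..v}" for u v n
  proof -
    have iff: "c / r n < Y n \<omega> \<longleftrightarrow> c < path_position (Suc n) \<omega>"
      "Y n \<omega> \<le> c / r n \<longleftrightarrow> path_position (Suc n) \<omega> \<le> c" for c \<omega>
      unfolding Y_def using r_pos[of n] by (simp_all add: divide_less_cancel divide_le_cancel not_less)
    show ?thesis
      unfolding iff law_def a(1) by (rule prob_path_position_interval[OF q])
  qed
  have law_sum: "sum (law n) {u<..v} \<le> real_of_int (v - u) * (32 / r n)" if "3 \<le> n" "u \<le> v" for u v n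
  proof -
    have "0 \<le> a" using a(2) by simp
    have r: "32 / r n = 32 * real (Suc n) powr - a"
      unfolding r_def powr_minus divide_inverse ..
    have "law n k \<le> 32 / r n" for k
      unfolding law_def r by (rule erw_law_le_powr[OF \<open>0 \<le> a\<close> a23 that(1)])
    then have "sum (law n) {u<..v} \<le> (\<Sum>k\<in>{u<..v}. 32 / r n)"
      by (intro sum_mono)
    then show ?thesis using that by simp
  qed
  have atom: "prob {\<omega> \<in> space M. L \<omega> = x} = 0" for x
  proof (rule no_atom_of_limit[OF _ _ Y_lim, where C = 33])
    fix e :: real assume e: "0 < e"
    \<comment> \<open>The window, rounded outwards, holds at most \<open>e * r n + 2\<close> lattice
      points of mass at most \<open>32 / r n\<close> each. The total
      \<open>32 * e + 64 / r n\<close> is at most \<open>33 * e\<close> for such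
      \<open>n\<close>.\<close>
    have "\<forall>\<^sub>F n in sequentially. 64 / e \<le> r n"
      using r_lim by (simp add: filterlim_at_top)
    then show "\<forall>\<^sub>F n in sequentially. prob {\<omega> \<in> space M. x - e < Y n \<omega> \<and> Y n \<omega> \<le> x + e} \<le> 33 * e"
      using eventually_ge_at_top[of 3]
    proof eventually_elim
      case (elim n)
      define A where "A = (x - e) * r n + real (Suc n)"
      define B where "B = (x + e) * r n + real (Suc n)"
      define u where "u = \<lfloor>A / 2\<rfloor>"
      define v where "v = \<lceil>B / 2\<rceil>"
      have u: "real_of_int u \<le> A / 2" "A / 2 - 1 < real_of_int u"
        unfolding u_def by linarith+
      have v: "B / 2 \<le> real_of_int v" "real_of_int v < B / 2 + 1"
        unfolding v_def by linarith+
      have int: "real_of_int (2 * k - int (Suc n)) = 2 * real_of_int k - real (Suc n)" for k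
        by simp
      have uv: "real_of_int (2 * u - int (Suc n)) \<le> (x - e) * r n" "(x + e) * r n \<le> real_of_int (2 * v - int (Suc n))"
      proof -
        have "(x - e) * r n = A - real (Suc n)" "(x + e) * r n = B - real (Suc n)"
          by (simp_all add: A_def B_def)
        then show "real_of_int (2 * u - int (Suc n)) \<le> (x - e) * r n" "(x + e) * r n \<le> real_of_int (2 * v - int (Suc n))"
          unfolding int using u(1) v(1) by simp_all
      qed
      have "B - A = 2 * (e * r n)"
        by (simp add: A_def B_def algebra_simps)
      then have vu: "real_of_int (v - u) \<le> e * r n + 2"
        using u(2) v(2) unfolding of_int_diff by linarith
      have "0 \<le> e * r n"
        using e r_pos[of n] by simp
      then have "real_of_int u \<le> real_of_int v"
        using u(1) v(1) \<open>B - A = 2 * (e * r n)\<close> by linarith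
      then have "u \<le> v" by simp
      have "prob {\<omega> \<in> space M. x - e < Y n \<omega> \<and> Y n \<omega> \<le> x + e} \<le> prob {\<omega> \<in> space M.
          real_of_int (2 * u - int (Suc n)) / r n < Y n \<omega> \<and> Y n \<omega> \<le> real_of_int (2 * v - int (Suc n)) / r n}"
      proof (intro finite_measure_mono)
        have "real_of_int (2 * u - int (Suc n)) / r n \<le> x - e" "x + e \<le> real_of_int (2 * v - int (Suc n)) / r n"
          using uv r_pos[of n] by (simp_all only: pos_divide_le_eq pos_le_divide_eq)
        then show "{\<omega> \<in> space M. x - e < Y n \<omega> \<and> Y n \<omega> \<le> x + e} \<subseteq> {\<omega> \<in> space M.
          real_of_int (2 * u - int (Suc n)) / r n < Y n \<omega> \<and> Y n \<omega> \<le> real_of_int (2 * v - int (Suc n)) / r n}"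
          by force
      qed measurable
      also have "\<dots> \<le> real_of_int (v - u) * (32 / r n)"
        unfolding interval using elim \<open>u \<le> v\<close> by (intro law_sum) auto
      also have "\<dots> \<le> (e * r n + 2) * (32 / r n)"
        using vu r_pos[of n] by (intro mult_right_mono) auto
      also have "\<dots> = 32 * e + 64 / r n"
        using r_pos[of n] by (simp add: field_simps)
      also have "\<dots> \<le> 33 * e"
        using elim e r_pos[of n] by (simp add: divide_le_eq mult.commute)
      finally show ?case .
    qed
  qed measurable
  define F where "F x = prob {\<omega> \<in> space M. L \<omega> \<le> x}" for x
  have F_lim: "(\<lambda>n. sum (law n) {u n<..v n}) \<longlonglongrightarrow> F y - F x"
    if "(\<lambda>n. real_of_int (2 * u n - int (Suc n)) / r n) \<longlonglongrightarrow> x"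
       "(\<lambda>n. real_of_int (2 * v n - int (Suc n)) / r n) \<longlonglongrightarrow> y"
       "\<And>n. u n \<le> v n" for u v x y
  proof -
    define G where "G k n = prob {\<omega> \<in> space M. Y n \<omega> \<le> real_of_int (2 * k - int (Suc n)) / r n}" for k n
    have "(\<lambda>n. G (v n) n - G (u n) n) \<longlonglongrightarrow> F y - F x"
      unfolding G_def F_def using that
      by (intro tendsto_diff prob_le_tendsto Y_lim atom) auto
    moreover have "G (v n) n - G (u n) n = sum (law n) {u n<..v n}" for n
    proof -
      have le: "real_of_int (2 * u n - int (Suc n)) / r n \<le> real_of_int (2 * v n - int (Suc n)) / r n"
        using that(3)[of n] r_pos[of n] by (intro divide_right_mono) auto
      have "G (v n) n = G (u n) n + prob {\<omega> \<in> space M. real_of_int (2 * u n - int (Suc n)) / r n < Y n \<omega> \<and>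
          Y n \<omega> \<le> real_of_int (2 * v n - int (Suc n)) / r n}"
        unfolding G_def
        by (subst finite_measure_Union[symmetric]) (use le in \<open>auto intro!: arg_cong[where f = prob]\<close>)
      then show ?thesis unfolding interval by simp
    qed
    ultimately show ?thesis by simp
  qed
  \<comment> \<open>Only the starting point \<open>x\<close>, the shift \<open>t\<close> and the
    length \<open>h\<close> are rounded, once each. The windows then begin at \<open>u\<close>,
    \<open>u + w\<close>, \<open>u + 2 * w\<close> (with \<open>w\<close> the rounded shift) and
    share one integer length, as \<open>lc_seq_window\<close> requires; rounding all end points
    separately would destroy this.\<close>
  define u where "u x n = \<lfloor>x / 2 * r n + real (Suc n) / 2\<rfloor>" for x n
  \<comment> \<open>Lattice points are \<open>2 / r n\<close> apart, hence the half; the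
    \<open>+ 0\<close> matches \<open>floor_affine_tendsto\<close> with zero offset.\<close>
  define w where "w h n = \<lfloor>h / 2 * r n + 0\<rfloor>" for h n
  have w_nonneg: "0 \<le> w h n" if "0 \<le> h" for h n
    using that r_pos[of n] by (simp add: w_def)
  have uw: "(\<lambda>n. real_of_int (2 * (u x n + i * w t n + j * w h n) - int (Suc n)) / r n)
      \<longlonglongrightarrow> x + real_of_int i * t + real_of_int j * h" for x t h and i j :: int
  proof -
    have "(\<lambda>n. 2 * ((real_of_int (u x n) - real (Suc n) / 2) / r n) + 2 * (real_of_int i * ((real_of_int (w t n) - 0) / r n))
        + 2 * (real_of_int j * ((real_of_int (w h n) - 0) / r n)))
        \<longlonglongrightarrow> 2 * (x / 2) + 2 * (real_of_int i * (t / 2)) + 2 * (real_of_int j * (h / 2))"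
      unfolding u_def w_def by (intro tendsto_add tendsto_mult tendsto_const floor_affine_tendsto r_lim)
    moreover have "2 * ((real_of_int (u x n) - real (Suc n) / 2) / r n) + 2 * (real_of_int i * ((real_of_int (w t n) - 0) / r n))
        + 2 * (real_of_int j * ((real_of_int (w h n) - 0) / r n))
        = real_of_int (2 * (u x n + i * w t n + j * w h n) - int (Suc n)) / r n" for n
      by (simp add: add_divide_distrib diff_divide_distrib)
    ultimately show ?thesis by simp
  qed
  have window: "(\<lambda>n. sum (law n) {u x n + i * w t n<..u x n + i * w t n + w h n})
      \<longlonglongrightarrow> F (x + real_of_int i * t + h) - F (x + real_of_int i * t)"
    if "0 \<le> h" for x t h i
    using uw[of x i t 0 h] uw[of x i t 1 h] w_nonneg[OF that]
    by (intro F_lim) simp_all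
  \<comment> \<open>About \<open>h / 2 * r n\<close> lattice points of mass at most
    \<open>32 / r n\<close> each give the constant 16.\<close>
  have lip: "F (x + h) - F x \<le> 16 * h" if "0 \<le> h" for x h
  proof (rule LIMSEQ_le)
    show "(\<lambda>n. sum (law n) {u x n<..u x n + w h n}) \<longlonglongrightarrow> F (x + h) - F x"
      using window[OF that, of x 0 0] by simp
    have "(\<lambda>n. 32 * ((real_of_int (w h n) - 0) / r n)) \<longlonglongrightarrow> 32 * (h / 2)"
      unfolding w_def by (intro tendsto_mult tendsto_const floor_affine_tendsto r_lim)
    then show "(\<lambda>n. 32 * (real_of_int (w h n) / r n)) \<longlonglongrightarrow> 16 * h"
      by simp
    show "\<exists>N. \<forall>n\<ge>N. sum (law n) {u x n<..u x n + w h n} \<le> 32 * (real_of_int (w h n) / r n)"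
    proof (intro exI allI impI)
      fix n :: nat assume "3 \<le> n"
      then show "sum (law n) {u x n<..u x n + w h n} \<le> 32 * (real_of_int (w h n) / r n)"
        using law_sum[of n "u x n" "u x n + w h n"] w_nonneg[OF that, of n] by (simp add: mult.commute)
    qed
  qed
  have mid_le: "(F (x + h) - F x) * (F (y + h) - F y) \<le> (F ((x + y) / 2 + h) - F ((x + y) / 2))\<^sup>2"
    if "0 < h" "x \<le> y" for x y h
  proof (rule LIMSEQ_le)
    define t where "t = (y - x) / 2"
    have t: "0 \<le> t" "x + t = (x + y) / 2" "x + 2 * t = y"
      using that by (simp_all add: t_def field_simps)
    define W where "W i n = sum (law n) {u x n + i * w t n<..u x n + i * w t n + w h n}" for i n
    have W: "(\<lambda>n. W 0 n) \<longlonglongrightarrow> F (x + h) - F x"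
      "(\<lambda>n. W 1 n) \<longlonglongrightarrow> F ((x + y) / 2 + h) - F ((x + y) / 2)"
      "(\<lambda>n. W 2 n) \<longlonglongrightarrow> F (y + h) - F y"
      using window[of h x 0 t] window[of h x 1 t] window[of h x 2 t] that
      by (simp_all add: W_def t)
    show "(\<lambda>n. W 0 n * W 2 n) \<longlonglongrightarrow> (F (x + h) - F x) * (F (y + h) - F y)"
      by (intro tendsto_mult W)
    show "(\<lambda>n. (W 1 n)\<^sup>2) \<longlonglongrightarrow> (F ((x + y) / 2 + h) - F ((x + y) / 2))\<^sup>2"
      by (intro tendsto_power W)
    show "\<exists>N. \<forall>n\<ge>N. W 0 n * W 2 n \<le> (W 1 n)\<^sup>2"
    proof (intro exI allI impI)
      fix n :: nat assume "4 \<le> n"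
      then have "lc_seq (law n)"
        unfolding law_def by (intro lc_seq_erw_law a)
      from lc_seq_window[OF this, of "w t n" "w h n" "u x n"] w_nonneg[OF t(1), of n] w_nonneg[of h n] that
      show "W 0 n * W 2 n \<le> (W 1 n)\<^sup>2"
        by (simp add: W_def)
    qed
  qed
  have mid: "(F (x + h) - F x) * (F (y + h) - F y) \<le> (F ((x + y) / 2 + h) - F ((x + y) / 2))\<^sup>2"
    if "0 < h" for x y h
    using mid_le[OF that, of x y] mid_le[OF that, of y x] by (cases "x \<le> y") (auto simp: mult.commute add.commute)
  interpret D: real_distribution "distr M borel L"
    by (rule real_distribution_distr) simp
  have F_cdf: "F = cdf (distr M borel L)"
    by (auto simp: F_def cdf_def measure_distr fun_eq_iff intro!: arg_cong[where f = prob])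
  have "mono F" "(F \<longlongrightarrow> 0) at_bot"
    unfolding F_cdf using D.cdf_lim_at_bot D.cdf_nondecreasing by (auto intro: monoI)
  then obtain f where f: "f \<in> borel_measurable borel" "log_concave f"
    "\<And>b. (\<integral>\<^sup>+x. ennreal (f x) * indicator {..b} x \<partial>lborel) = ennreal (F b)"
    using lebesgue_density_of_log_concave_increments[OF _ _ lip mid] by blast
  have "distributed M lborel L (\<lambda>x. ennreal (f x))"
  proof (rule distributedI_borel_atMost[where g = F])
    show "AE x in lborel. 0 \<le> f x"
      using f(2) by (simp add: log_concave_def)
    show "emeasure M {\<omega> \<in> space M. L \<omega> \<le> b} = ennreal (F b)" for b
      by (simp add: F_def emeasure_eq_measure)
    have "(\<integral>\<^sup>+x. ennreal (f x * indicator {..b} x) \<partial>lborel) =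
        (\<integral>\<^sup>+x. ennreal (f x) * indicator {..b} x \<partial>lborel)" for b
      by (intro nn_integral_cong) (auto simp: indicator_def)
    then show "(\<integral>\<^sup>+x. ennreal (f x * indicator {..b} x) \<partial>lborel) = ennreal (F b)" for b
      by (simp only: f(3))
  qed (use f in auto)
  then show ?thesis using f(2) by blast
qed

end

theorem corollary2p4:
  fixes M :: "'w measure" and a p :: real
    and X :: "nat \<Rightarrow> 'w \<Rightarrow> int" and U :: "nat \<Rightarrow> 'w \<Rightarrow> nat" and \<epsilon> :: "nat \<Rightarrow> 'w \<Rightarrow> int"
    and L1 :: "'w \<Rightarrow> real"
  assumes a_def: "a = 2 * p - 1"
    and a_range: "1/2 < a" "a \<le> erw_a0"
    and erw: "elephant_random_walk M p 1 X U \<epsilon>"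
    and limit: "is_erw_limit M a X L1"
  shows "\<exists>f :: real \<Rightarrow> real. distributed M lborel L1 (\<lambda>x. ennreal (f x)) \<and> log_concave f"
proof -
  interpret elephant_random_walk M p 1 X U \<epsilon> by (rule erw)
  have "(erw_a0 + 3) * (erw_a0\<^sup>2 + erw_a0 - 1) = 0"
    using erw_a0_root(2) by (simp add: power2_eq_square power3_eq_cube algebra_simps)
  then have "erw_a0\<^sup>2 + erw_a0 = 1"
    using erw_a0_root(1) by simp
  moreover have "a\<^sup>2 \<le> erw_a0\<^sup>2"
    using a_range by (intro power_mono) auto
  ultimately have "a\<^sup>2 + a \<le> 1"
    using a_range by linarith
  then show ?thesis
    using log_concave_density_of_limit[OF refl a_def _ _ limit] a_range by simp
qed

end
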